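(* Let $q>0$ and let $Q$ be a star body in $\mathbb{R}^n$. For every origin-centered ellipsoid $E\subset\mathbb{R}^n$ with lengths of the semi-axes $b_1\le\cdots\le b_n$, $$\widetilde{V}_q(E,Q)\approx\begin{cases} b_1\cdots b_n\, b_n^{q-n}, & \text{if } q\in[n,\infty),\\ b_1\cdots b_{\lceil q\rceil}\, b_{\lceil q\rceil}^{q-\lceil q\rceil}, & \text{if } q\in(0,n)\text{ is not an integer},\\ b_1\cdots b_q\,\bigl(1+\log(b_{q+1}/b_q)\bigr), & \text{if } q\in(0,n)\text{ is an integer},\end{cases}$$ where "$\approx$" means that the ratio of the two sides has positive upper and lower bounds depending only on $n$, $q$, $\min\rho_Q$ and $\max\rho_Q$.
   Context: $\mathbb{S}^{n-1}$ is the unit sphere of $\mathbb{R}^n$ and $du$ is the standard surface measure on it. A star body is a compact set $Q\subset\mathbb{R}^n$, star-shaped with respect to the origin (the segment joining any point of $Q$ to the origin lies in $Q$), whose radial function $\rho_Q(u)=\max\{\lambda:\lambda u\in Q\}$, $u\in\mathbb{S}^{n-1}$, is positive and continuous. Ellipsoids are non-degenerate, so $b_1>0$. The $q$-th dual mixed volume of a convex body $K$ (compact, convex, non-empty interior) containing the origin in its interior and a star body $Q$ is $$\widetilde{V}_q(K,Q)=\frac1n\int_{\mathbb{S}^{n-1}}\rho_K^q(u)\rho_Q^{n-q}(u)\,du.$$ $\lceil q\rceil$ is the smallest integer greater than or equal to $q$. *)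

theory Defs
  imports "HOL-Analysis.Analysis"
begin

(* The standard surface measure of the unit sphere is defined as the normalised cone measure,
   sigma(A) = n * vol {t u | u in A, 0 < t <= 1}, which is the measure making integration in
   polar coordinates dx = r^(n-1) dr du valid.  For n = 1 it is the counting measure on {-1, 1}. *)
definition sphere_measure :: "'a::euclidean_space measure" where
  "sphere_measure =
     scale_measure (of_nat DIM('a))
       (distr (restrict_space lborel (cball 0 1 - {0})) (restrict_space borel (sphere 0 1))
          (\<lambda>x. x /\<^sub>R norm x))"

lemma emeasure_sphere_measure:
  fixes A :: "'a::euclidean_space set"
  assumes "A \<in> sets borel" "A \<subseteq> sphere 0 1"
  shows "emeasure sphere_measure A =
           of_nat DIM('a) * emeasure lborel {t *\<^sub>R u | t u. 0 < t \<and> t \<le> 1 \<and> u \<in> A}"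
proof -
  let ?f = "\<lambda>x::'a. x /\<^sub>R norm x" and ?D = "cball 0 1 - {0::'a}"
  have D: "?D \<in> sets lborel" by auto
  have f: "?f \<in> borel_measurable (restrict_space lborel ?D)"
    by (rule measurable_restrict_space1) measurable
  have m: "?f \<in> measurable (restrict_space lborel ?D) (restrict_space borel (sphere 0 1))"
    by (rule measurable_restrict_space2[OF _ f]) (auto simp: space_restrict_space)
  have A: "A \<in> sets (restrict_space borel (sphere (0::'a) 1))"
    using assms by (auto simp: sets_restrict_space)
  have eq: "?f -` A \<inter> space (restrict_space lborel ?D)
          = {t *\<^sub>R u | t u. 0 < t \<and> t \<le> 1 \<and> u \<in> A}" (is "?L = ?R")
  proof
    show "?L \<subseteq> ?R"
    proof
      fix x assume x: "x \<in> ?L"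
      then have "x = norm x *\<^sub>R ?f x" "0 < norm x" "norm x \<le> 1" "?f x \<in> A"
        by (auto simp: space_restrict_space)
      then show "x \<in> ?R" by blast
    qed
    show "?R \<subseteq> ?L"
      using assms(2) by (fastforce simp: space_restrict_space)
  qed
  show ?thesis
    unfolding sphere_measure_def emeasure_scale_measure emeasure_distr[OF m A] eq
    using eq by (subst emeasure_restrict_space) (auto simp: space_restrict_space)
qed

definition radial :: "'a::real_normed_vector set \<Rightarrow> 'a \<Rightarrow> real" where
  "radial Q u = (GREATEST t. t *\<^sub>R u \<in> Q)"

definition star_body :: "'a::euclidean_space set \<Rightarrow> bool" where
  "star_body Q \<longleftrightarrow>
     compact Q \<and> 0 \<in> Q \<and> (\<forall>x\<in>Q. closed_segment 0 x \<subseteq> Q) \<and>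
     continuous_on (sphere 0 1) (radial Q) \<and> (\<forall>u\<in>sphere 0 1. 0 < radial Q u)"

definition min_radial :: "'a::euclidean_space set \<Rightarrow> real" where
  "min_radial Q = (LEAST r. r \<in> radial Q ` sphere 0 1)"

definition max_radial :: "'a::euclidean_space set \<Rightarrow> real" where
  "max_radial Q = (GREATEST r. r \<in> radial Q ` sphere 0 1)"

definition dual_mixed_volume :: "real \<Rightarrow> 'a::euclidean_space set \<Rightarrow> 'a set \<Rightarrow> real" where
  "dual_mixed_volume q K Q =
     1 / real DIM('a) *
     (LINT u|sphere_measure. radial K u powr q * radial Q u powr (real DIM('a) - q))"

(* The semi-axes b 1, ..., b n are indexed from 1; values of b outside {1..n} are irrelevant.
   The vectors v i are the directions of the axes. *)
definition ellipsoid_with_semiaxes :: "'a::euclidean_space set \<Rightarrow> (nat \<Rightarrow> real) \<Rightarrow> bool" where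
  "ellipsoid_with_semiaxes E b \<longleftrightarrow>
     (\<forall>i\<in>{1..DIM('a)}. 0 < b i) \<and> mono_on {1..DIM('a)} b \<and>
     (\<exists>v :: nat \<Rightarrow> 'a.
        (\<forall>i\<in>{1..DIM('a)}. \<forall>j\<in>{1..DIM('a)}. v i \<bullet> v j = (if i = j then 1 else 0)) \<and>
        E = {x. (\<Sum>i=1..DIM('a). (x \<bullet> v i)\<^sup>2 / (b i)\<^sup>2) \<le> 1})"

definition semiaxes_expression :: "nat \<Rightarrow> real \<Rightarrow> (nat \<Rightarrow> real) \<Rightarrow> real" where
  "semiaxes_expression n q b =
     (let k = nat \<lceil>q\<rceil> in
      if real n \<le> q then (\<Prod>i=1..n. b i) * b n powr (q - real n)
      else if q \<notin> \<int> then (\<Prod>i=1..k. b i) * b k powr (q - real k)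
      else (\<Prod>i=1..k. b i) * (1 + ln (b (k + 1) / b k)))"

end

theory Submission imports Defs begin

text \<open>
  In polar coordinates the dual mixed volume is the integral over the unit ball of
  \<open>\<rho>\<^sub>E(x/|x|)\<^sup>q \<rho>\<^sub>Q(x/|x|)\<^sup>n\<^sup>-\<^sup>q\<close>; the second factor lies between two positive constants,
  and the first one is \<open>(|x|/g(x))\<^sup>q\<close> for the norm \<open>g\<close> with unit ball \<open>E\<close>. Since
  \<open>|x|/g(x) \<le> min(b\<^sub>n, 1/g(x))\<close> on the unit ball, writing the \<open>q\<close>-th power as the integral of
  \<open>q t\<^sup>q\<^sup>-\<^sup>1\<close> and exchanging the integrals leaves, up to constants, the integral of
  \<open>t\<^sup>q\<^sup>-\<^sup>1 \<Prod>\<^sub>i min(1, b\<^sub>i/t)\<close> over \<open>0 < t \<le> b\<^sub>n\<close>: the product is comparable to the volume of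
  the part of the unit ball where \<open>t g(x) \<le> 1\<close>. For the lower bound one keeps only the points
  whose coordinates are at most \<open>1/\<surd>n\<close> in modulus and whose last one is at least
  half of that. The integral in \<open>t\<close> is estimated by cutting at \<open>b\<^sub>k\<close> for \<open>k = \<lceil>q\<rceil>\<close> (and, for an
  integer \<open>q < n\<close>, also at \<open>b\<^bsub>k+1\<^esub>\<close>); the interval between the two cuts yields the logarithm.
\<close>

section \<open>The one-dimensional integral\<close>

lemma nn_integral_half_open_has_integral:
  fixes f :: "real \<Rightarrow> real"
  assumes [measurable]: "f \<in> borel_measurable borel" and nonneg: "\<And>t. 0 \<le> f t"
    and I: "(f has_integral I) {a..b}"
  shows "(\<integral>\<^sup>+t\<in>{a<..b}. ennreal (f t) \<partial>lborel) = ennreal I"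
proof -
  have "(\<integral>\<^sup>+t\<in>{a<..b}. ennreal (f t) \<partial>lborel) =
      (\<integral>\<^sup>+t. ennreal (if t \<in> {a..b} then f t else 0) \<partial>lborel)"
    by (rule nn_integral_cong_AE, rule AE_mp[OF AE_lborel_singleton[of a]])
       (auto simp: indicator_def)
  also have "\<dots> = ennreal I"
    using I nonneg by (intro nn_integral_has_integral_lborel)
      (simp_all only: has_integral_restrict_UNIV, auto)
  finally show ?thesis .
qed

lemma nn_integral_half_open_split:
  fixes f :: "real \<Rightarrow> ennreal"
  assumes [measurable]: "f \<in> borel_measurable borel" and "r \<le> s" "s \<le> u"
  shows "(\<integral>\<^sup>+t\<in>{r<..u}. f t \<partial>lborel) = (\<integral>\<^sup>+t\<in>{r<..s}. f t \<partial>lborel) + (\<integral>\<^sup>+t\<in>{s<..u}. f t \<partial>lborel)"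
proof -
  have "(\<integral>\<^sup>+t\<in>{r<..u}. f t \<partial>lborel) = (\<integral>\<^sup>+t. (f t * indicator {r<..s} t + f t * indicator {s<..u} t) \<partial>lborel)"
    using assms by (intro nn_integral_cong) (auto simp: indicator_def)
  also have "\<dots> = (\<integral>\<^sup>+t\<in>{r<..s}. f t \<partial>lborel) + (\<integral>\<^sup>+t\<in>{s<..u}. f t \<partial>lborel)"
    by (rule nn_integral_add) auto
  finally show ?thesis .
qed

lemma nn_integral_powr_from_0:
  fixes p s c :: real
  assumes "p > -1" "s \<ge> 0" "c \<ge> 0"
  shows "(\<integral>\<^sup>+t\<in>{0<..s}. ennreal (c * t powr p) \<partial>lborel) = ennreal (c * (s powr (p + 1) / (p + 1)))"
  using assms
  by (intro nn_integral_half_open_has_integral has_integral_mult_right has_integral_powr_from_0) auto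

text \<open>For \<open>p < -1\<close> the antiderivative \<open>t powr (p + 1) / (p + 1)\<close> is
  negative, so discarding its value at \<open>s\<close> leaves a bound that is independent of the
  right endpoint.\<close>

lemma nn_integral_powr_tail_le:
  fixes p r s c :: real
  assumes "p < -1" "0 < r" "r \<le> s" "c \<ge> 0"
  shows "(\<integral>\<^sup>+t\<in>{r<..s}. ennreal (c * t powr p) \<partial>lborel) \<le> ennreal (c * (r powr (p + 1) / (- p - 1)))"
proof -
  have "((\<lambda>t. t powr p) has_integral (s powr (p + 1) / (p + 1) - r powr (p + 1) / (p + 1))) {r..s}"
  proof (rule fundamental_theorem_of_calculus[OF \<open>r \<le> s\<close>])
    fix t assume "t \<in> {r..s}"
    then have "((\<lambda>t. t powr (p + 1) / (p + 1)) has_real_derivative t powr p) (at t)"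
      using assms DERIV_cdivide[OF has_real_derivative_powr[of t "p + 1"], of "p + 1"] by simp
    then show "((\<lambda>t. t powr (p + 1) / (p + 1)) has_vector_derivative t powr p) (at t within {r..s})"
      by (simp add: has_field_derivative_at_within has_real_derivative_iff_has_vector_derivative[symmetric])
  qed
  then have "(\<integral>\<^sup>+t\<in>{r<..s}. ennreal (c * t powr p) \<partial>lborel) =
      ennreal (c * (s powr (p + 1) / (p + 1) - r powr (p + 1) / (p + 1)))"
    using assms by (intro nn_integral_half_open_has_integral has_integral_mult_right) auto
  also have "\<dots> \<le> ennreal (c * (r powr (p + 1) / (- p - 1)))"
  proof (intro ennreal_leI mult_left_mono)
    have "s powr (p + 1) / (p + 1) \<le> 0" using assms by (simp add: divide_nonneg_neg)
    moreover have "r powr (p + 1) / (- p - 1) = - (r powr (p + 1) / (p + 1))"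
      using minus_divide_right[of "r powr (p + 1)" "p + 1"] by (simp add: algebra_simps)
    ultimately show "s powr (p + 1) / (p + 1) - r powr (p + 1) / (p + 1) \<le> r powr (p + 1) / (- p - 1)"
      by linarith
  qed (use assms in auto)
  finally show ?thesis .
qed

lemma nn_integral_inverse:
  fixes r s c :: real
  assumes "0 < r" "r \<le> s" "c \<ge> 0"
  shows "(\<integral>\<^sup>+t\<in>{r<..s}. ennreal (c * t powr -1) \<partial>lborel) = ennreal (c * ln (s / r))"
proof -
  have "((\<lambda>t. t powr -1) has_integral (ln s - ln r)) {r..s}"
  proof (rule fundamental_theorem_of_calculus[OF \<open>r \<le> s\<close>])
    fix t assume "t \<in> {r..s}"
    then have "(ln has_real_derivative t powr -1) (at t)"
      using assms by (auto intro!: derivative_eq_intros simp: powr_minus field_simps)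
    then show "(ln has_vector_derivative t powr -1) (at t within {r..s})"
      by (simp add: has_field_derivative_at_within has_real_derivative_iff_has_vector_derivative[symmetric])
  qed
  then have "(\<integral>\<^sup>+t\<in>{r<..s}. ennreal (c * t powr -1) \<partial>lborel) = ennreal (c * (ln s - ln r))"
    using assms by (intro nn_integral_half_open_has_integral has_integral_mult_right) auto
  then show ?thesis
    using assms by (simp add: ln_div)
qed

section \<open>The box profile and its integral\<close>

text \<open>The numbers \<open>min 1 (b i / t)\<close> are the half-widths of a box around the part
  of the ellipsoid scaled by \<open>1 / t\<close> that lies in the unit ball. The weight
  \<open>t powr (q - 1)\<close> comes from writing a \<open>q\<close>-th power as an
  integral.\<close>

definition box_profile :: "nat \<Rightarrow> real \<Rightarrow> (nat \<Rightarrow> real) \<Rightarrow> real \<Rightarrow> real" where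
  "box_profile n q b t = t powr (q - 1) * (\<Prod>i=1..n. min 1 (b i / t))"

text \<open>The range stops at \<open>b n\<close> because the ratio of the norm to the gauge of the
  ellipsoid never exceeds the largest semi-axis.\<close>

definition box_profile_integral :: "nat \<Rightarrow> real \<Rightarrow> (nat \<Rightarrow> real) \<Rightarrow> ennreal" where
  "box_profile_integral n q b = (\<integral>\<^sup>+t\<in>{0<..b n}. ennreal (box_profile n q b t) \<partial>lborel)"

text \<open>One formula for all three cases: \<open>k = n\<close> if \<open>q \<ge> n\<close>, and
  otherwise \<open>k\<close> is the ceiling of \<open>q\<close>. If \<open>q = k\<close> the power
  is 1 and only the logarithmic factor is missing.\<close>

definition partial_product :: "real \<Rightarrow> (nat \<Rightarrow> real) \<Rightarrow> nat \<Rightarrow> real" where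
  "partial_product q b k = (\<Prod>i=1..k. b i) * b k powr (q - real k)"

lemma box_profile_measurable [measurable]: "box_profile n q b \<in> borel_measurable borel"
  unfolding box_profile_def by measurable

locale semiaxes =
  fixes n :: nat and b :: "nat \<Rightarrow> real"
  assumes pos: "\<And>i. i \<in> {1..n} \<Longrightarrow> 0 < b i" and mono: "mono_on {1..n} b"
begin

lemma semiaxis_le: "1 \<le> i \<Longrightarrow> i \<le> j \<Longrightarrow> j \<le> n \<Longrightarrow> b i \<le> b j"
  using mono by (auto simp: mono_on_def)

lemma prod_semiaxes_pos: "k \<le> n \<Longrightarrow> 0 < (\<Prod>i=1..k. b i)"
  using pos by (intro prod_pos) auto

lemma partial_product_pos: "k \<in> {1..n} \<Longrightarrow> 0 < partial_product q b k"
  using prod_semiaxes_pos[of k] pos[of k] by (auto simp: partial_product_def)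

lemma box_profile_split:
  assumes "k \<le> n"
  shows "box_profile n q b t =
    t powr (q - 1) * ((\<Prod>i=1..k. min 1 (b i / t)) * (\<Prod>i=Suc k..n. min 1 (b i / t)))"
proof -
  have "{1..n} = {1..k} \<union> {Suc k..n}" using assms by auto
  then show ?thesis
    by (simp add: box_profile_def prod.union_disjoint)
qed

lemma prod_div_power:
  assumes "0 < t"
  shows "t powr (q - 1) * (\<Prod>i=1..k. b i / t) = (\<Prod>i=1..k. b i) * t powr (q - 1 - real k)"
  using assms by (simp add: prod_dividef powr_diff powr_realpow)

text \<open>The first \<open>k\<close> minima are bounded by \<open>b i / t\<close> and the others
  by 1. Since \<open>k\<close> is free, the exponent of \<open>t\<close> can be chosen to suit the
  range of integration.\<close>

lemma box_profile_le:
  assumes "k \<le> n" "0 < t"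
  shows "box_profile n q b t \<le> (\<Prod>i=1..k. b i) * t powr (q - 1 - real k)"
proof -
  have "(\<Prod>i=1..k. min 1 (b i / t)) * (\<Prod>i=Suc k..n. min 1 (b i / t)) \<le> (\<Prod>i=1..k. b i / t) * 1"
    using assms pos by (intro mult_mono prod_mono prod_le_1 prod_nonneg) (auto simp: less_imp_le)
  then have "box_profile n q b t \<le> t powr (q - 1) * (\<Prod>i=1..k. b i / t)"
    unfolding box_profile_split[OF assms(1)] by (intro mult_left_mono) auto
  then show ?thesis using prod_div_power[OF assms(2)] by simp
qed

text \<open>Between two consecutive semi-axes monotonicity decides every minimum: it is
  \<open>b i / t\<close> up to index \<open>k\<close> and 1 afterwards.\<close>

lemma box_profile_eq:
  assumes "1 \<le> k" "k < n" "b k \<le> t" "t \<le> b (Suc k)"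
  shows "box_profile n q b t = (\<Prod>i=1..k. b i) * t powr (q - 1 - real k)"
proof -
  have t: "0 < t" using assms pos[of k] by auto
  have "min 1 (b i / t) = b i / t" if "i \<in> {1..k}" for i
    using that semiaxis_le[of i k] assms t by (auto simp: divide_simps)
  then have 1: "(\<Prod>i=1..k. min 1 (b i / t)) = (\<Prod>i=1..k. b i / t)"
    by (intro prod.cong) auto
  have 2: "min 1 (b i / t) = 1" if "i \<in> {Suc k..n}" for i
    using that semiaxis_le[of "Suc k" i] assms t by (auto simp: divide_simps)
  then have 2: "(\<Prod>i=Suc k..n. min 1 (b i / t)) = 1"
    by (intro prod.neutral) auto
  show ?thesis
    using box_profile_split[of k q t] assms(2) prod_div_power[OF t, of q k] unfolding 1 2 by simp
qed

text \<open>For \<open>i \<le> k\<close> both \<open>b i\<close> and \<open>t\<close> are at most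
  \<open>b k\<close>, so \<open>b i / b k\<close> is below the minimum; the later minima are 1.
  These bounds do not involve \<open>t\<close>, which leaves the exponent \<open>q - 1\<close>,
  integrable at 0 for \<open>q > 0\<close>.\<close>

lemma box_profile_ge:
  assumes "1 \<le> k" "k \<le> n" "0 < t" "t \<le> b k"
  shows "(\<Prod>i=1..k. b i) / b k ^ k * t powr (q - 1) \<le> box_profile n q b t"
proof -
  have bk: "0 < b k" using assms pos by auto
  have "b i / b k \<le> min 1 (b i / t)" if "i \<in> {1..k}" for i
  proof -
    have "b i \<le> b k" "0 < b i" using that semiaxis_le[of i k] assms pos[of i] by auto
    then show ?thesis using assms bk by (auto intro!: divide_left_mono simp: divide_simps)
  qed
  then have "(\<Prod>i=1..k. b i / b k) \<le> (\<Prod>i=1..k. min 1 (b i / t))"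
    using assms pos by (intro prod_mono) (auto simp: less_imp_le)
  moreover have "min 1 (b i / t) = 1" if "i \<in> {Suc k..n}" for i
    using that semiaxis_le[of k i] assms by (auto simp: divide_simps)
  then have "(\<Prod>i=Suc k..n. min 1 (b i / t)) = 1"
    by (intro prod.neutral) auto
  ultimately show ?thesis
    using box_profile_split[of k q t] assms(2)
      mult_left_mono[of "\<Prod>i=1..k. b i / b k" "\<Prod>i=1..k. min 1 (b i / t)" "t powr (q - 1)"]
    by (simp add: prod_dividef mult.commute)
qed

lemma initial_integral_ge:
  assumes "k \<in> {1..n}" "q > 0"
  shows "ennreal (partial_product q b k / q) \<le> (\<integral>\<^sup>+t\<in>{0<..b k}. ennreal (box_profile n q b t) \<partial>lborel)"
proof -
  have bk: "0 < b k" using assms pos by auto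
  have "partial_product q b k / q = (\<Prod>i=1..k. b i) / b k ^ k * (b k powr (q - 1 + 1) / (q - 1 + 1))"
    using bk by (simp add: partial_product_def powr_diff powr_realpow)
  also have "ennreal \<dots> = (\<integral>\<^sup>+t\<in>{0<..b k}. ennreal ((\<Prod>i=1..k. b i) / b k ^ k * t powr (q - 1)) \<partial>lborel)"
    using assms bk prod_semiaxes_pos[of k] by (intro nn_integral_powr_from_0[symmetric]) auto
  also have "\<dots> \<le> (\<integral>\<^sup>+t\<in>{0<..b k}. ennreal (box_profile n q b t) \<partial>lborel)"
    using box_profile_ge[of k] assms
    by (intro nn_integral_mono) (auto simp: indicator_def intro!: ennreal_leI)
  finally show ?thesis .
qed

text \<open>Only the first \<open>k - 1\<close> factors are used. They give the exponent
  \<open>q - k\<close>, which exceeds -1 by assumption and so is integrable at 0. The factor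
  \<open>b k\<close> missing from the product is supplied by the integrated power.\<close>

lemma initial_integral_le:
  assumes "k \<in> {1..n}" "q > real k - 1"
  shows "(\<integral>\<^sup>+t\<in>{0<..b k}. ennreal (box_profile n q b t) \<partial>lborel)
    \<le> ennreal (partial_product q b k / (q - real k + 1))"
proof -
  obtain m where k: "k = Suc m" using assms by (cases k) auto
  have bk: "0 < b (Suc m)" using assms pos k by auto
  have "(\<integral>\<^sup>+t\<in>{0<..b k}. ennreal (box_profile n q b t) \<partial>lborel)
      \<le> (\<integral>\<^sup>+t\<in>{0<..b k}. ennreal ((\<Prod>i=1..m. b i) * t powr (q - real k)) \<partial>lborel)"
    using box_profile_le[of m _ q] assms k
    by (intro nn_integral_mono) (auto simp: indicator_def algebra_simps intro!: ennreal_leI)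
  also have "\<dots> = ennreal ((\<Prod>i=1..m. b i) * (b k powr (q - real k + 1) / (q - real k + 1)))"
    using assms bk k prod_semiaxes_pos[of m] by (intro nn_integral_powr_from_0) auto
  also have "(\<Prod>i=1..m. b i) * (b k powr (q - real k + 1) / (q - real k + 1)) =
      partial_product q b k / (q - real k + 1)"
    using bk by (simp add: partial_product_def k powr_mult_base algebra_simps)
  finally show ?thesis .
qed

text \<open>Here all of the first \<open>k\<close> factors are used: the exponent
  \<open>q - 1 - k\<close> is below -1, so the bound does not depend on \<open>b n\<close>.\<close>

lemma tail_integral_le:
  assumes "k \<in> {1..n}" "q < real k"
  shows "(\<integral>\<^sup>+t\<in>{b k<..b n}. ennreal (box_profile n q b t) \<partial>lborel)
    \<le> ennreal (partial_product q b k / (real k - q))"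
proof -
  have bk: "0 < b k" "b k \<le> b n" using assms pos semiaxis_le[of k n] by auto
  have "(\<integral>\<^sup>+t\<in>{b k<..b n}. ennreal (box_profile n q b t) \<partial>lborel)
      \<le> (\<integral>\<^sup>+t\<in>{b k<..b n}. ennreal ((\<Prod>i=1..k. b i) * t powr (q - 1 - real k)) \<partial>lborel)"
    using box_profile_le[of k _ q] assms bk
    by (intro nn_integral_mono) (auto simp: indicator_def intro!: ennreal_leI)
  also have "\<dots> \<le> ennreal ((\<Prod>i=1..k. b i) * (b k powr (q - 1 - real k + 1) / (- (q - 1 - real k) - 1)))"
    using assms bk prod_semiaxes_pos[of k] by (intro nn_integral_powr_tail_le) auto
  also have "(\<Prod>i=1..k. b i) * (b k powr (q - 1 - real k + 1) / (- (q - 1 - real k) - 1)) =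
      partial_product q b k / (real k - q)"
    by (simp add: partial_product_def algebra_simps)
  finally show ?thesis .
qed

text \<open>For \<open>q = k\<close> the exponent between \<open>b k\<close> and
  \<open>b (Suc k)\<close> is exactly -1, which is the source of the logarithm.\<close>

lemma middle_integral:
  assumes "1 \<le> k" "k < n"
  shows "(\<integral>\<^sup>+t\<in>{b k<..b (Suc k)}. ennreal (box_profile n (real k) b t) \<partial>lborel)
    = ennreal (partial_product (real k) b k * ln (b (Suc k) / b k))"
proof -
  have bk: "0 < b k" "b k \<le> b (Suc k)" using assms pos semiaxis_le[of k "Suc k"] by auto
  have "(\<integral>\<^sup>+t\<in>{b k<..b (Suc k)}. ennreal (box_profile n (real k) b t) \<partial>lborel)
      = (\<integral>\<^sup>+t\<in>{b k<..b (Suc k)}. ennreal ((\<Prod>i=1..k. b i) * t powr -1) \<partial>lborel)"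
    using box_profile_eq[of k _ "real k"] assms
    by (intro nn_integral_cong) (auto simp: indicator_def)
  also have "\<dots> = ennreal ((\<Prod>i=1..k. b i) * ln (b (Suc k) / b k))"
    using assms bk prod_semiaxes_pos[of k] by (intro nn_integral_inverse) auto
  finally show ?thesis using bk by (simp add: partial_product_def)
qed

text \<open>A single cut at \<open>b k\<close> suffices: \<open>k - 1 < q\<close> controls the
  initial part, and \<open>q < k\<close> controls the tail unless \<open>k = n\<close>, when there
  is no tail.\<close>

lemma box_profile_integral_bounds:
  assumes "q > 0" "k \<in> {1..n}" "real k - 1 < q" "k = n \<or> q < real k"
  shows "ennreal (partial_product q b k / q) \<le> box_profile_integral n q b"
    and "box_profile_integral n q b \<le>
      ennreal ((1 / (q - real k + 1) + 1 / \<bar>real k - q\<bar>) * partial_product q b k)"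
proof -
  let ?f = "\<lambda>t. ennreal (box_profile n q b t)"
  have bk: "0 < b k" "b k \<le> b n" using assms pos semiaxis_le[of k n] by auto
  have split: "box_profile_integral n q b = (\<integral>\<^sup>+t\<in>{0<..b k}. ?f t \<partial>lborel) + (\<integral>\<^sup>+t\<in>{b k<..b n}. ?f t \<partial>lborel)"
    unfolding box_profile_integral_def using bk by (intro nn_integral_half_open_split) auto
  show "ennreal (partial_product q b k / q) \<le> box_profile_integral n q b"
    using add_increasing2[OF _ initial_integral_ge] assms split by auto
  note P = partial_product_pos[OF assms(2), of q]
  \<comment> \<open>For \<open>k = n\<close> the interval is empty and any nonnegative bound serves.
    This includes \<open>q = n\<close>, where the division by zero yields 0.\<close>
  have tail: "(\<integral>\<^sup>+t\<in>{b k<..b n}. ?f t \<partial>lborel) \<le> ennreal (partial_product q b k / \<bar>real k - q\<bar>)"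
    using assms(4)
  proof
    assume "k = n" then show ?thesis by simp
  next
    assume "q < real k" then show ?thesis using tail_integral_le[OF assms(2)] by simp
  qed
  have "box_profile_integral n q b \<le> ennreal (partial_product q b k / (q - real k + 1)) +
      ennreal (partial_product q b k / \<bar>real k - q\<bar>)"
    unfolding split using initial_integral_le[OF assms(2,3)] tail by (rule add_mono)
  also have "\<dots> = ennreal ((1 / (q - real k + 1) + 1 / \<bar>real k - q\<bar>) * partial_product q b k)"
    using P assms(3) by (subst ennreal_plus[symmetric]) (auto simp: distrib_right)
  finally show "box_profile_integral n q b \<le>
      ennreal ((1 / (q - real k + 1) + 1 / \<bar>real k - q\<bar>) * partial_product q b k)" .
qed

text \<open>With \<open>q = k\<close> a tail starting at \<open>b k\<close> would meet the exponent
  -1. The stretch up to \<open>b (Suc k)\<close> is therefore integrated exactly, and the tail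
  beyond it is estimated with \<open>k + 1\<close> factors, where the exponent is -2.\<close>

lemma box_profile_integral_bounds_nat:
  assumes "1 \<le> k" "k < n"
  shows "ennreal ((1 / real k) * (partial_product (real k) b k * (1 + ln (b (Suc k) / b k))))
      \<le> box_profile_integral n (real k) b"
    and "box_profile_integral n (real k) b
      \<le> ennreal (2 * (partial_product (real k) b k * (1 + ln (b (Suc k) / b k))))"
proof -
  let ?f = "\<lambda>t. ennreal (box_profile n (real k) b t)"
  let ?P = "partial_product (real k) b k" and ?L = "ln (b (Suc k) / b k)"
  have k: "k \<in> {1..n}" "Suc k \<in> {1..n}" using assms by auto
  have bk: "0 < b k" "b k \<le> b (Suc k)" "b (Suc k) \<le> b n"
    using assms pos semiaxis_le[of k "Suc k"] semiaxis_le[of "Suc k" n] by auto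
  have P: "0 < ?P" by (rule partial_product_pos[OF k(1)])
  have L: "0 \<le> ?L" using bk by simp
  have split: "box_profile_integral n (real k) b = (\<integral>\<^sup>+t\<in>{0<..b k}. ?f t \<partial>lborel) +
      (ennreal (?P * ?L) + (\<integral>\<^sup>+t\<in>{b (Suc k)<..b n}. ?f t \<partial>lborel))"
    unfolding box_profile_integral_def middle_integral[OF assms, symmetric]
    using bk by (subst nn_integral_half_open_split[of _ 0 "b k" "b n"], simp, simp, simp,
      subst nn_integral_half_open_split[of _ "b k" "b (Suc k)" "b n"]) simp_all
  \<comment> \<open>The initial part contributes \<open>?P / k\<close> and the middle part
    \<open>?P * ?L\<close>; as \<open>1 / k \<le> 1\<close>, the smaller constant
    \<open>1 / k\<close> serves for both.\<close>
  have "(1 / real k) * (?P * (1 + ?L)) \<le> ?P / real k + ?P * ?L"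
    using P L assms mult_mono[of "1 / real k" 1 "?P * ?L" "?P * ?L"] by (simp add: algebra_simps)
  then have "ennreal ((1 / real k) * (?P * (1 + ?L))) \<le> ennreal (?P / real k) + ennreal (?P * ?L)"
    using P L by (simp add: ennreal_plus[symmetric] ennreal_leI del: ennreal_plus)
  also have "\<dots> \<le> box_profile_integral n (real k) b"
    unfolding split using initial_integral_ge[OF k(1), of "real k"] assms
    by (intro add_mono) (auto intro: add_increasing2)
  finally show "ennreal ((1 / real k) * (?P * (1 + ?L))) \<le> box_profile_integral n (real k) b" .
  \<comment> \<open>The exponent \<open>k - (k + 1)\<close> is -1 and cancels the additional factor
    \<open>b (Suc k)\<close>.\<close>
  have "partial_product (real k) b (Suc k) = ?P"
    using bk by (simp add: partial_product_def powr_minus)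
  then have tail: "(\<integral>\<^sup>+t\<in>{b (Suc k)<..b n}. ?f t \<partial>lborel) \<le> ennreal ?P"
    using tail_integral_le[OF k(2), of "real k"] by simp
  have "box_profile_integral n (real k) b \<le> ennreal ?P + (ennreal (?P * ?L) + ennreal ?P)"
    unfolding split using initial_integral_le[OF k(1), of "real k"] tail by (intro add_mono) auto
  also have "\<dots> = ennreal (?P + (?P * ?L + ?P))"
    using P L by (simp add: ennreal_plus[symmetric] del: ennreal_plus)
  also have "\<dots> \<le> ennreal (2 * (?P * (1 + ?L)))"
    using P L by (intro ennreal_leI) (simp add: algebra_simps)
  finally show "box_profile_integral n (real k) b \<le> ennreal (2 * (?P * (1 + ?L)))" .
qed

end

text \<open>The constants are fixed before \<open>b\<close>, so they depend on \<open>n\<close> and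
  \<open>q\<close> alone. The integer case below \<open>n\<close> is separated from the rest, which
  a single choice of \<open>k\<close> covers.\<close>

lemma box_profile_integral_approx:
  fixes q :: real
  assumes "q > 0" "n \<ge> 1"
  obtains a A where "0 < a" "0 < A"
    "\<And>b. semiaxes n b \<Longrightarrow> 0 < semiaxes_expression n q b \<and>
      ennreal (a * semiaxes_expression n q b) \<le> box_profile_integral n q b \<and>
      box_profile_integral n q b \<le> ennreal (A * semiaxes_expression n q b)"
proof (cases "q < real n \<and> q \<in> \<int>")
  case True
  define k where "k = nat \<lceil>q\<rceil>"
  have q: "q = real k" using True assms by (auto simp: k_def elim!: Ints_cases)
  have k: "1 \<le> k" "k < n" using q True assms by auto
  have W: "semiaxes_expression n q b = partial_product (real k) b k * (1 + ln (b (Suc k) / b k))"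
    if "semiaxes n b" for b
    using q k semiaxes.pos[OF that, of k] by (simp add: semiaxes_expression_def partial_product_def)
  have "0 < semiaxes_expression n q b" if "semiaxes n b" for b
    unfolding W[OF that] using that k semiaxes.partial_product_pos[OF that, of k "real k"]
      semiaxes.pos[OF that, of k] semiaxes.semiaxis_le[OF that, of k "Suc k"]
    by (auto intro!: mult_pos_pos add_pos_nonneg)
  with that[of "1 / real k" 2] k W q show ?thesis
    using semiaxes.box_profile_integral_bounds_nat[OF _ k] by (metis zero_less_numeral of_nat_0_less_iff zero_less_divide_1_iff less_le_trans zero_less_one)
next
  case False
  \<comment> \<open>For \<open>q \<ge> n\<close> the ceiling of \<open>q\<close> may exceed the
    number of semi-axes, so \<open>k\<close> is capped at \<open>n\<close>.\<close>
  define k where "k = (if real n \<le> q then n else nat \<lceil>q\<rceil>)"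
  have k: "k \<in> {1..n}" "real k - 1 < q" "k = n \<or> q < real k"
  proof -
    have "q < real (nat \<lceil>q\<rceil>) \<and> nat \<lceil>q\<rceil> \<le> n \<and> real (nat \<lceil>q\<rceil>) - 1 < q \<and> 1 \<le> nat \<lceil>q\<rceil>" if "q < real n"
    proof -
      \<comment> \<open>Non-integrality makes \<open>q\<close> strictly smaller than its ceiling, as
        the tail estimate requires.\<close>
      have "q \<notin> \<int>" using False that by auto
      then have "q \<noteq> of_int \<lceil>q\<rceil>" by (metis Ints_of_int)
      moreover have "\<lceil>q\<rceil> \<le> int n" using that by (simp add: ceiling_le_iff)
      moreover have "0 < \<lceil>q\<rceil>" using assms by simp
      ultimately show ?thesis by linarith
    qed
    then show "k \<in> {1..n}" "real k - 1 < q" "k = n \<or> q < real k"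
      using assms by (auto simp: k_def)
  qed
  have W: "semiaxes_expression n q b = partial_product q b k" for b
    using False by (auto simp: semiaxes_expression_def partial_product_def k_def Let_def)
  have "0 < 1 / (q - real k + 1) + 1 / \<bar>real k - q\<bar>"
    using k(2) by (intro add_pos_nonneg) auto
  moreover have "0 < 1 / q" using assms by simp
  ultimately show ?thesis
    using that[of "1 / q" "1 / (q - real k + 1) + 1 / \<bar>real k - q\<bar>"] unfolding W
    using semiaxes.box_profile_integral_bounds[OF _ assms(1) k] semiaxes.partial_product_pos[OF _ k(1)]
    by simp
qed


section \<open>Orthonormal coordinates and Lebesgue measure\<close>

definition orthonormal_family :: "(nat \<Rightarrow> real ^ 'n) \<Rightarrow> bool" where
  "orthonormal_family v \<longleftrightarrow>
     (\<forall>i\<in>{1..CARD('n)}. \<forall>j\<in>{1..CARD('n)}. v i \<bullet> v j = (if i = j then 1 else 0))"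

text \<open>The axes are numbered by naturals but coordinates by the type \<open>'n\<close>;
  \<open>h\<close> matches the two index sets. \<open>T\<close> is the matrix whose rows are the
  axis vectors, hence orthogonal.\<close>

lemma orthonormal_coordinates:
  fixes v :: "nat \<Rightarrow> real ^ 'n"
  assumes "orthonormal_family v"
  obtains h :: "nat \<Rightarrow> 'n" and T where "bij_betw h {1..CARD('n)} UNIV" "orthogonal_transformation T"
    "\<And>x i. i \<in> {1..CARD('n)} \<Longrightarrow> T x $ h i = x \<bullet> v i"
proof -
  obtain h :: "nat \<Rightarrow> 'n" where h: "bij_betw h {1..CARD('n)} UNIV"
    using finite_same_card_bij[of "{1..CARD('n)}" "UNIV :: 'n set"] by auto
  define g where "g = inv_into {1..CARD('n)} h"
  have g: "g j \<in> {1..CARD('n)}" "h (g j) = j" for j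
    using h bij_betw_inv_into_right[OF h, of j] inv_into_into[of j h "{1..CARD('n)}"]
    by (auto simp: g_def bij_betw_def)
  have gh: "g (h i) = i" if "i \<in> {1..CARD('n)}" for i
    using bij_betw_inv_into_left[OF h that] by (simp add: g_def)
  define A where "A = (\<chi> j. v (g j))"
  have row: "row j A = v (g j)" for j by (simp add: row_def A_def vec_eq_iff)
  have "g i = g j \<longleftrightarrow> i = j" for i j using g(2) by metis
  then have "orthogonal_matrix A"
    using assms g(1) unfolding orthogonal_matrix_orthonormal_rows row
    by (auto simp: orthonormal_family_def norm_eq_1 orthogonal_def)
  then have "orthogonal_transformation ((*v) A)"
    by (simp add: orthogonal_transformation_matrix)
  moreover have "(A *v x) $ h i = x \<bullet> v i" if "i \<in> {1..CARD('n)}" for x i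
    using gh[OF that] by (simp add: matrix_vector_mul_component A_def inner_commute)
  ultimately show ?thesis using that h by blast
qed

text \<open>Parseval's identity: \<open>T\<close> preserves norms and its coordinates are the inner
  products with the axes.\<close>

lemma norm_square_orthonormal:
  fixes v :: "nat \<Rightarrow> real ^ 'n"
  assumes "orthonormal_family v"
  shows "(norm x)\<^sup>2 = (\<Sum>i=1..CARD('n). (x \<bullet> v i)\<^sup>2)"
proof -
  obtain h T where h: "bij_betw h {1..CARD('n)} (UNIV :: 'n set)" and T: "orthogonal_transformation T"
    and Th: "\<And>x i. i \<in> {1..CARD('n)} \<Longrightarrow> T x $ h i = x \<bullet> v i"
    using orthonormal_coordinates[OF assms] by blast
  have "(norm x)\<^sup>2 = (norm (T x))\<^sup>2"
    using T by (simp add: orthogonal_transformation_norm)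
  also have "\<dots> = (\<Sum>j\<in>UNIV. (T x $ j)\<^sup>2)"
    by (simp add: norm_vec_def L2_set_def sum_nonneg)
  also have "\<dots> = (\<Sum>i=1..CARD('n). (T x $ h i)\<^sup>2)"
    using sum.reindex_bij_betw[OF h, of "\<lambda>j. (T x $ j)\<^sup>2"] by simp
  finally show ?thesis using Th by simp
qed

section \<open>Invariance of volume under orthogonal maps\<close>

lemma nn_integral_lborel_translate:
  fixes f :: "'a::euclidean_space \<Rightarrow> ennreal"
  assumes [measurable]: "f \<in> borel_measurable borel"
  shows "(\<integral>\<^sup>+x. f (a + x) \<partial>lborel) = (\<integral>\<^sup>+x. f x \<partial>lborel)"
proof -
  have "(\<integral>\<^sup>+x. f x \<partial>lborel) = (\<integral>\<^sup>+x. f x \<partial>distr lborel borel ((+) a))"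
    by (simp add: lborel_distr_plus)
  then show ?thesis by (simp add: nn_integral_distr)
qed

text \<open>The invariance of Lebesgue measure in the library is restricted to index types of class
  \<^class>\<open>wellorder\<close>. The proof below is instead the uniqueness argument for Haar measure: with
  \<open>B\<close> the unit ball, both \<open>\<lambda>(T\<^sup>-\<^sup>1 A) \<lambda>(B)\<close> and \<open>\<lambda>(A) \<lambda>(B)\<close> are the integral of
  \<open>1\<^sub>B(y - T x) 1\<^sub>A(y)\<close> over all pairs \<open>(x, y)\<close>.\<close>

lemma emeasure_orthogonal_vimage:
  fixes T :: "'a::euclidean_space \<Rightarrow> 'a"
  assumes T: "orthogonal_transformation T" and A [measurable]: "A \<in> sets borel"
  shows "emeasure lborel (T -` A) = emeasure lborel A"
proof -
  let ?B = "cball (0::'a) 1"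
  have lin: "linear T" and bij: "bij T"
    using T by (auto simp: orthogonal_transformation_linear orthogonal_transformation_bij)
  have [measurable]: "T \<in> borel_measurable borel"
    using lin by (intro borel_measurable_continuous_onI linear_continuous_on)
      (simp add: linear_conv_bounded_linear)
  have add: "T (x + y) = T x + T y" and diff: "T (x - y) = T x - T y" for x y
    using lin by (simp_all add: linear_add linear_diff)
  have norm: "norm (T x) = norm x" for x
    using T by (simp add: orthogonal_transformation_norm)
  have inv: "T (inv T y) = y" for y
    using bij by (simp add: bij_def surj_f_inv_f)
  have B [measurable]: "?B \<in> sets borel" by simp
  have TA [measurable]: "T -` A \<in> sets borel"
    using measurable_sets_borel[of T borel A] by simp
  have "emeasure lborel (T -` A) * emeasure lborel ?B =
      (\<integral>\<^sup>+y. emeasure lborel (T -` A) * indicator ?B y \<partial>lborel)"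
    by (rule nn_integral_cmult_indicator[symmetric]) simp
  also have "\<dots> = (\<integral>\<^sup>+y. \<integral>\<^sup>+x. indicator ?B y * indicator A (T x + y) \<partial>lborel \<partial>lborel)"
  proof (rule nn_integral_cong)
    fix y
    have "emeasure lborel (T -` A) = (\<integral>\<^sup>+x. indicator A (T x) \<partial>lborel)"
      using nn_integral_indicator[of "T -` A" lborel] TA
      by (simp add: indicator_vimage[unfolded comp_def, symmetric] indicator_def)
    \<comment> \<open>Translating \<open>x\<close> by \<open>inv T y\<close> preserves the integral
      and, \<open>T\<close> being additive, brings \<open>y\<close> outside
      \<open>T\<close>.\<close>
    also have "\<dots> = (\<integral>\<^sup>+x. indicator A (T (inv T y + x)) \<partial>lborel)"
      by (rule nn_integral_lborel_translate[symmetric]) measurable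
    also have "\<dots> = (\<integral>\<^sup>+x. indicator A (T x + y) \<partial>lborel)"
      by (simp add: add inv add.commute)
    finally show "emeasure lborel (T -` A) * indicator ?B y =
        (\<integral>\<^sup>+x. indicator ?B y * indicator A (T x + y) \<partial>lborel)"
      by (simp add: nn_integral_cmult mult.commute)
  qed
  also have "\<dots> = (\<integral>\<^sup>+x. \<integral>\<^sup>+y. indicator ?B y * indicator A (T x + y) \<partial>lborel \<partial>lborel)"
  proof (rule lborel_pair.Fubini')
    have T': "(\<lambda>p. T (fst p) + snd p) \<in> borel_measurable (lborel \<Otimes>\<^sub>M lborel)"
      and snd: "snd \<in> borel_measurable ((lborel :: 'a measure) \<Otimes>\<^sub>M (lborel :: 'a measure))"
      by measurable
    show "(\<lambda>(x, y). indicator ?B y * indicator A (T x + y) :: ennreal) \<in> borel_measurable (lborel \<Otimes>\<^sub>M lborel)"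
      using borel_measurable_times_ennreal[OF measurable_compose[OF snd borel_measurable_indicator[OF B]]
          measurable_compose[OF T' borel_measurable_indicator[OF A]]]
      by (simp add: case_prod_beta')
  qed
  also have "\<dots> = (\<integral>\<^sup>+x. \<integral>\<^sup>+y. indicator ?B (y - T x) * indicator A y \<partial>lborel \<partial>lborel)"
  proof (rule nn_integral_cong)
    fix x
    show "(\<integral>\<^sup>+y. indicator ?B y * indicator A (T x + y) \<partial>lborel) =
        (\<integral>\<^sup>+y. indicator ?B (y - T x) * indicator A y \<partial>lborel)"
      by (subst nn_integral_lborel_translate[of "\<lambda>y. indicator ?B (y - T x) * indicator A y" "T x",
            symmetric]) simp_all
  qed
  also have "\<dots> = (\<integral>\<^sup>+y. \<integral>\<^sup>+x. indicator ?B (y - T x) * indicator A y \<partial>lborel \<partial>lborel)"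
  proof (rule lborel_pair.Fubini')
    have T': "(\<lambda>p. fst p - T (snd p)) \<in> borel_measurable (lborel \<Otimes>\<^sub>M lborel)"
      and fst: "fst \<in> borel_measurable ((lborel :: 'a measure) \<Otimes>\<^sub>M (lborel :: 'a measure))"
      by measurable
    show "(\<lambda>(y, x). indicator ?B (y - T x) * indicator A y :: ennreal) \<in> borel_measurable (lborel \<Otimes>\<^sub>M lborel)"
      using borel_measurable_times_ennreal[OF measurable_compose[OF T' borel_measurable_indicator[OF B]]
          measurable_compose[OF fst borel_measurable_indicator[OF A]]]
      by (simp add: case_prod_beta')
  qed
  also have "\<dots> = (\<integral>\<^sup>+y. emeasure lborel ?B * indicator A y \<partial>lborel)"
  proof (rule nn_integral_cong)
    fix y
    \<comment> \<open>Since \<open>T\<close> is an isometry, the points \<open>x\<close> with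
      \<open>T x\<close> in the unit ball about \<open>y\<close> form the unit ball about
      \<open>inv T y\<close>; the inner integral is then the same for all \<open>y\<close>.\<close>
    have "norm (y - T x) = norm (inv T y - x)" for x
      using norm[of "inv T y - x"] by (simp add: diff inv)
    then have "(\<integral>\<^sup>+x. indicator ?B (y - T x) \<partial>lborel) = (\<integral>\<^sup>+x. indicator ?B (- inv T y + x) \<partial>lborel)"
      by (intro nn_integral_cong) (simp add: indicator_def norm_minus_commute)
    also have "\<dots> = emeasure lborel ?B"
      by (subst nn_integral_lborel_translate) simp_all
    finally show "(\<integral>\<^sup>+x. indicator ?B (y - T x) * indicator A y \<partial>lborel) = emeasure lborel ?B * indicator A y"
      by (simp add: nn_integral_multc)
  qed
  also have "\<dots> = emeasure lborel A * emeasure lborel ?B"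
    by (subst nn_integral_cmult_indicator) (simp_all add: mult.commute)
  finally have "emeasure lborel (T -` A) * emeasure lborel ?B = emeasure lborel A * emeasure lborel ?B" .
  \<comment> \<open>Cancelling the volume of the ball requires it to be finite and nonzero.\<close>
  moreover have "emeasure lborel ?B \<noteq> top"
    using emeasure_lborel_cball_finite[of "0::'a" 1] by simp
  moreover have "emeasure lborel ?B \<noteq> 0"
    using content_cball_pos[of 1 "0::'a"] by (auto simp: measure_def)
  ultimately show ?thesis
    using mult_divide_eq_ennreal[of "emeasure lborel ?B"] by metis
qed

text \<open>The set is the preimage under \<open>T\<close> of a coordinate box. The bounds being
  compatible, that box is nonempty and its volume is the product of its edge lengths.\<close>

lemma emeasure_orthonormal_box:
  fixes v :: "nat \<Rightarrow> real ^ 'n"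
  assumes "orthonormal_family v" and lu: "\<And>i. i \<in> {1..CARD('n)} \<Longrightarrow> l i \<le> u i"
  shows "emeasure lborel {x. \<forall>i\<in>{1..CARD('n)}. l i \<le> x \<bullet> v i \<and> x \<bullet> v i \<le> u i}
    = ennreal (\<Prod>i=1..CARD('n). u i - l i)"
proof -
  obtain h T where h: "bij_betw h {1..CARD('n)} (UNIV :: 'n set)" and T: "orthogonal_transformation T"
    and Th: "\<And>x i. i \<in> {1..CARD('n)} \<Longrightarrow> T x $ h i = x \<bullet> v i"
    using orthonormal_coordinates[OF assms(1)] by blast
  let ?S = "{x. \<forall>i\<in>{1..CARD('n)}. l i \<le> x \<bullet> v i \<and> x \<bullet> v i \<le> u i}"
  define g where "g = inv_into {1..CARD('n)} h"
  have gh: "g (h i) = i" if "i \<in> {1..CARD('n)}" for i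
    using bij_betw_inv_into_left[OF h that] by (simp add: g_def)
  have all: "(\<forall>j. P j) \<longleftrightarrow> (\<forall>i\<in>{1..CARD('n)}. P (h i))" for P
  proof -
    have "(\<forall>i\<in>{1..CARD('n)}. P (h i)) \<longleftrightarrow> (\<forall>j\<in>h ` {1..CARD('n)}. P j)" by blast
    then show ?thesis unfolding bij_betw_imp_surj_on[OF h] by simp
  qed
  define B where "B = cbox (\<chi> j. l (g j)) (\<chi> j. u (g j))"
  have TB: "T x \<in> B \<longleftrightarrow> x \<in> ?S" for x
    unfolding B_def mem_box_cart by (subst all) (auto simp: gh Th)
  have "?S = T -` B" using TB by auto
  then have "emeasure lborel ?S = emeasure lborel B"
    using emeasure_orthogonal_vimage[OF T, of B] by (simp add: B_def)
  also have "\<dots> = ennreal (measure lborel B)"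
    unfolding B_def
    by (intro emeasure_eq_ennreal_measure less_imp_neq[OF emeasure_lborel_cbox_finite, simplified])
  also have "measure lborel B = (\<Prod>j\<in>UNIV. u (g j) - l (g j))"
  proof -
    have "\<forall>j. l (g j) \<le> u (g j)" by (subst all) (simp add: gh lu)
    then have "B \<noteq> {}" by (simp add: B_def interval_ne_empty_cart)
    then show ?thesis by (simp add: B_def content_cbox_cart)
  qed
  also have "\<dots> = (\<Prod>i=1..CARD('n). u (g (h i)) - l (g (h i)))"
    using prod.reindex_bij_betw[OF h, of "\<lambda>j. u (g j) - l (g j)"] by simp
  also have "\<dots> = (\<Prod>i=1..CARD('n). u i - l i)"
    using gh by (intro prod.cong) auto
  finally show ?thesis .
qed

section \<open>Exchanging the order of integration\<close>

text \<open>Tonelli's theorem on the region of pairs \<open>(x, t)\<close> with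
  \<open>t * g x \<le> 1\<close>, the layer-cake step. The domain \<open>D\<close> is left open
  because the upper estimate uses the punctured ball and the lower one a shell.\<close>

lemma nn_integral_sublevel_swap:
  fixes g :: "'a::euclidean_space \<Rightarrow> real" and w :: "real \<Rightarrow> real"
  assumes [measurable]: "g \<in> borel_measurable borel" "D \<in> sets borel" "w \<in> borel_measurable borel"
  shows "(\<integral>\<^sup>+x\<in>D. (\<integral>\<^sup>+t\<in>{t\<in>{0<..s}. t * g x \<le> 1}. ennreal (w t) \<partial>lborel) \<partial>lborel)
    = (\<integral>\<^sup>+t\<in>{0<..s}. ennreal (w t) * emeasure lborel {x\<in>D. t * g x \<le> 1} \<partial>lborel)"
proof -
  let ?h = "\<lambda>(x, t). ennreal (w t) * indicator {p. fst p \<in> D \<and> snd p \<in> {0<..s} \<and> snd p * g (fst p) \<le> 1} (x, t)"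
  have "{p \<in> space (borel \<Otimes>\<^sub>M borel). fst p \<in> D \<and> snd p \<in> {0<..s} \<and> snd p * g (fst p) \<le> 1}
      \<in> sets (borel \<Otimes>\<^sub>M borel)"
    by measurable
  then have [measurable]: "{p. fst p \<in> D \<and> snd p \<in> {0<..s} \<and> snd p * g (fst p) \<le> 1}
      \<in> sets (lborel \<Otimes>\<^sub>M lborel)"
    by (simp add: space_pair_measure cong: sets_pair_measure_cong)
  have h: "?h \<in> borel_measurable (lborel \<Otimes>\<^sub>M lborel)"
    by measurable
  have "(\<integral>\<^sup>+x\<in>D. (\<integral>\<^sup>+t\<in>{t\<in>{0<..s}. t * g x \<le> 1}. ennreal (w t) \<partial>lborel) \<partial>lborel)
    = (\<integral>\<^sup>+x. \<integral>\<^sup>+t. ?h (x, t) \<partial>lborel \<partial>lborel)"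
    by (intro nn_integral_cong) (auto simp: indicator_def intro!: nn_integral_cong)
  also have "\<dots> = (\<integral>\<^sup>+t. \<integral>\<^sup>+x. ?h (x, t) \<partial>lborel \<partial>lborel)"
    using lborel_pair.Fubini'[of "\<lambda>x t. ?h (x, t)"] h by simp
  also have "\<dots> = (\<integral>\<^sup>+t\<in>{0<..s}. ennreal (w t) * emeasure lborel {x\<in>D. t * g x \<le> 1} \<partial>lborel)"
  proof (intro nn_integral_cong)
    fix t :: real
    have [measurable]: "{x\<in>D. t * g x \<le> 1} \<in> sets borel" by measurable
    have "(\<integral>\<^sup>+x. ?h (x, t) \<partial>lborel) =
        (\<integral>\<^sup>+x. (ennreal (w t) * indicator {0<..s} t) * indicator {x\<in>D. t * g x \<le> 1} x \<partial>lborel)"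
      by (intro nn_integral_cong) (auto simp: indicator_def)
    also have "\<dots> = (ennreal (w t) * indicator {0<..s} t) * emeasure lborel {x\<in>D. t * g x \<le> 1}"
      by (rule nn_integral_cmult_indicator) simp
    finally show "(\<integral>\<^sup>+x. ?h (x, t) \<partial>lborel) =
        ennreal (w t) * emeasure lborel {x\<in>D. t * g x \<le> 1} * indicator {0<..s} t"
      by (simp add: mult_ac)
  qed
  finally show ?thesis .
qed


section \<open>Ellipsoids\<close>

text \<open>For positive \<open>b i\<close> and orthonormal \<open>v i\<close> this is the Minkowski
  functional of the ellipsoid with these semi-axes and directions.\<close>

definition ellipsoid_gauge :: "(nat \<Rightarrow> real) \<Rightarrow> (nat \<Rightarrow> real ^ 'n) \<Rightarrow> real ^ 'n \<Rightarrow> real" where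
  "ellipsoid_gauge b v x = sqrt (\<Sum>i=1..CARD('n). (x \<bullet> v i)\<^sup>2 / (b i)\<^sup>2)"

lemma ellipsoid_gauge_scaleR: "ellipsoid_gauge b v (c *\<^sub>R x) = \<bar>c\<bar> * ellipsoid_gauge b v x"
  by (simp add: ellipsoid_gauge_def power_mult_distrib real_sqrt_mult
      flip: sum_distrib_left times_divide_eq_right)

lemma ellipsoid_gauge_nonneg: "0 \<le> ellipsoid_gauge b v x"
  by (simp add: ellipsoid_gauge_def sum_nonneg)

lemma continuous_on_ellipsoid_gauge: "continuous_on S (ellipsoid_gauge b v)"
  unfolding ellipsoid_gauge_def divide_inverse by (intro continuous_intros)

lemma ellipsoid_gauge_measurable [measurable]: "ellipsoid_gauge b v \<in> borel_measurable borel"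
  by (intro borel_measurable_continuous_onI continuous_on_ellipsoid_gauge)

locale ellipsoid_axes = semiaxes "CARD('n)" b for b :: "nat \<Rightarrow> real" +
  fixes v :: "nat \<Rightarrow> real ^ 'n"
  assumes orthonormal: "orthonormal_family v"
begin

abbreviation "egauge \<equiv> ellipsoid_gauge b v"

lemma dim_ge_1: "1 \<le> CARD('n)"
  by (simp add: Suc_leI)

lemma semiaxis_pos: "1 \<le> i \<Longrightarrow> i \<le> CARD('n) \<Longrightarrow> 0 < b i"
  using pos by simp

text \<open>A single summand is at most the whole sum; geometrically, the ellipsoid lies in the box
  with half-widths \<open>b i\<close>.\<close>

lemma abs_inner_le_gauge:
  assumes "i \<in> {1..CARD('n)}"
  shows "\<bar>x \<bullet> v i\<bar> \<le> b i * egauge x"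
proof -
  have "(x \<bullet> v i)\<^sup>2 / (b i)\<^sup>2 \<le> (egauge x)\<^sup>2"
    using member_le_sum[of i "{1..CARD('n)}" "\<lambda>i. (x \<bullet> v i)\<^sup>2 / (b i)\<^sup>2"] assms
    by (simp add: ellipsoid_gauge_def sum_nonneg)
  then have "(x \<bullet> v i)\<^sup>2 \<le> (b i * egauge x)\<^sup>2"
    using pos[OF assms] by (simp add: power_mult_distrib divide_simps mult.commute)
  then show ?thesis
    using pos[OF assms] ellipsoid_gauge_nonneg[of b v x] by (simp add: abs_le_square_iff[symmetric])
qed

text \<open>Replacing every semi-axis by the largest one shows that the ellipsoid lies in the ball
  of radius \<open>b n\<close>.\<close>

lemma norm_le_gauge: "norm x \<le> b CARD('n) * egauge x"
proof -
  have "(norm x)\<^sup>2 = (\<Sum>i=1..CARD('n). (x \<bullet> v i)\<^sup>2)"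
    by (rule norm_square_orthonormal[OF orthonormal])
  also have "\<dots> \<le> (\<Sum>i=1..CARD('n). (b CARD('n))\<^sup>2 * ((x \<bullet> v i)\<^sup>2 / (b i)\<^sup>2))"
  proof (rule sum_mono)
    fix i assume i: "i \<in> {1..CARD('n)}"
    then have "0 < b i" "b i \<le> b CARD('n)" using pos semiaxis_le[of i "CARD('n)"] by auto
    then have "1 \<le> (b CARD('n))\<^sup>2 / (b i)\<^sup>2" by (simp add: divide_simps)
    then show "(x \<bullet> v i)\<^sup>2 \<le> (b CARD('n))\<^sup>2 * ((x \<bullet> v i)\<^sup>2 / (b i)\<^sup>2)"
      using mult_right_mono[of 1 "(b CARD('n))\<^sup>2 / (b i)\<^sup>2" "(x \<bullet> v i)\<^sup>2"] by simp
  qed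
  also have "\<dots> = (b CARD('n) * egauge x)\<^sup>2"
    by (simp add: ellipsoid_gauge_def sum_nonneg sum_distrib_left power_mult_distrib)
  finally show ?thesis
    using semiaxis_pos[OF dim_ge_1] ellipsoid_gauge_nonneg[of b v x] by (simp add: abs_le_square_iff[symmetric])
qed

lemma gauge_pos: "x \<noteq> 0 \<Longrightarrow> 0 < egauge x"
  using norm_le_gauge[of x] ellipsoid_gauge_nonneg[of b v x] by (cases "egauge x = 0") auto

text \<open>By homogeneity \<open>t *\<^sub>R x\<close> lies in the ellipsoid exactly when
  \<open>\<bar>t\<bar> * egauge x \<le> 1\<close>, and the largest such \<open>t\<close> is the
  reciprocal of the gauge.\<close>

lemma radial_ellipsoid:
  assumes "x \<noteq> 0"
  shows "radial {x. (\<Sum>i=1..CARD('n). (x \<bullet> v i)\<^sup>2 / (b i)\<^sup>2) \<le> 1} x = 1 / egauge x"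
proof -
  have "t *\<^sub>R x \<in> {x. (\<Sum>i=1..CARD('n). (x \<bullet> v i)\<^sup>2 / (b i)\<^sup>2) \<le> 1} \<longleftrightarrow> \<bar>t\<bar> * egauge x \<le> 1" for t
    unfolding ellipsoid_gauge_scaleR[symmetric] by (simp add: ellipsoid_gauge_def)
  then show ?thesis
    unfolding radial_def using gauge_pos[OF assms]
    by (intro Greatest_equality) (auto simp del: inner_scaleR_left simp: divide_simps abs_le_iff
        intro: order_trans[OF mult_right_mono[OF abs_ge_self]])
qed

section \<open>Two-sided estimate of the integral over the ball\<close>

text \<open>The power is the integral of \<open>q * t powr (q - 1)\<close> over
  \<open>0 < t \<le> norm x / egauge x\<close>, and such \<open>t\<close> satisfy
  \<open>t \<le> b n\<close> and \<open>t * egauge x \<le> 1\<close>. After the exchange the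
  sublevel set is enclosed in a box with edges \<open>2 * min 1 (b i / t)\<close>, whence the factor
  \<open>2 ^ n\<close>.\<close>

lemma sphere_ellipsoid_integral_le:
  assumes "q > 0"
  shows "(\<integral>\<^sup>+x\<in>cball 0 1 - {0}. ennreal ((norm x / egauge x) powr q) \<partial>lborel)
    \<le> ennreal (q * 2 ^ CARD('n)) * box_profile_integral CARD('n) q b"
proof -
  let ?w = "\<lambda>t. q * t powr (q - 1)" and ?D = "cball 0 1 - {0 :: real ^ 'n}"
  have "(\<integral>\<^sup>+x\<in>?D. ennreal ((norm x / egauge x) powr q) \<partial>lborel)
      \<le> (\<integral>\<^sup>+x\<in>?D. (\<integral>\<^sup>+t\<in>{t\<in>{0<..b CARD('n)}. t * egauge x \<le> 1}. ennreal (?w t) \<partial>lborel) \<partial>lborel)"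
  proof (intro nn_integral_mono)
    fix x :: "real ^ 'n"
    define s where "s = norm x / egauge x"
    have "ennreal (s powr q) \<le> (\<integral>\<^sup>+t\<in>{t\<in>{0<..b CARD('n)}. t * egauge x \<le> 1}. ennreal (?w t) \<partial>lborel)" if "x \<in> ?D"
    proof -
      have g: "0 < egauge x" using that gauge_pos by auto
      then have s: "0 \<le> s" "s \<le> b CARD('n)" "s * egauge x \<le> 1"
        using norm_le_gauge[of x] that by (auto simp: s_def divide_simps)
      have "ennreal (s powr q) = (\<integral>\<^sup>+t\<in>{0<..s}. ennreal (?w t) \<partial>lborel)"
        using nn_integral_powr_from_0[of "q - 1" s q] assms s by simp
      also have "\<dots> \<le> (\<integral>\<^sup>+t\<in>{t\<in>{0<..b CARD('n)}. t * egauge x \<le> 1}. ennreal (?w t) \<partial>lborel)"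
      proof (rule nn_integral_mono)
        fix t
        have "t * egauge x \<le> 1" if "t \<le> s"
          using mult_right_mono[OF that, of "egauge x"] g s by linarith
        then show "ennreal (?w t) * indicator {0<..s} t
            \<le> ennreal (?w t) * indicator {t\<in>{0<..b CARD('n)}. t * egauge x \<le> 1} t"
          using s by (auto simp: indicator_def)
      qed
      finally show ?thesis .
    qed
    then show "ennreal ((norm x / egauge x) powr q) * indicator ?D x
      \<le> (\<integral>\<^sup>+t\<in>{t\<in>{0<..b CARD('n)}. t * egauge x \<le> 1}. ennreal (?w t) \<partial>lborel) * indicator ?D x"
      by (auto simp: indicator_def s_def)
  qed
  also have "\<dots> = (\<integral>\<^sup>+t\<in>{0<..b CARD('n)}. ennreal (?w t) * emeasure lborel {x\<in>?D. t * egauge x \<le> 1} \<partial>lborel)"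
    by (rule nn_integral_sublevel_swap) auto
  also have "\<dots> \<le> (\<integral>\<^sup>+t. ennreal (q * 2 ^ CARD('n)) * (ennreal (box_profile CARD('n) q b t) * indicator {0<..b CARD('n)} t) \<partial>lborel)"
  proof (rule nn_integral_mono)
    fix t :: real
    have "ennreal (?w t) * emeasure lborel {x\<in>?D. t * egauge x \<le> 1}
        \<le> ennreal (q * 2 ^ CARD('n) * box_profile CARD('n) q b t)" if t: "0 < t"
    proof -
      let ?m = "\<lambda>i. min 1 (b i / t)"
      let ?B = "{x. \<forall>i\<in>{1..CARD('n)}. - ?m i \<le> x \<bullet> v i \<and> x \<bullet> v i \<le> ?m i}"
      have m: "0 \<le> ?m i" if "i \<in> {1..CARD('n)}" for i using pos[OF that] t by simp
      \<comment> \<open>The bound 1 is Cauchy-Schwarz in the unit ball; the bound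
        \<open>b i / t\<close> comes from the gauge.\<close>
      have "\<bar>x \<bullet> v i\<bar> \<le> ?m i" if x: "x \<in> ?D" "t * egauge x \<le> 1" and i: "i \<in> {1..CARD('n)}" for x i
      proof -
        have "norm (v i) = 1"
          using orthonormal i by (auto simp: orthonormal_family_def norm_eq_1)
        then have "\<bar>x \<bullet> v i\<bar> \<le> 1" using Cauchy_Schwarz_ineq2[of x "v i"] x by auto
        moreover have "b i * egauge x \<le> b i * (1 / t)"
          using x t pos[OF i] by (intro mult_left_mono) (auto simp: field_simps)
        then have "\<bar>x \<bullet> v i\<bar> \<le> b i / t"
          using abs_inner_le_gauge[OF i, of x] by simp
        ultimately show ?thesis by simp
      qed
      then have "{x\<in>?D. t * egauge x \<le> 1} \<subseteq> ?B" by (auto simp: abs_le_iff minus_le_iff)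
      moreover have "closed ?B"
        unfolding Ball_def by (intro closed_Collect_all closed_Collect_imp open_Collect_const
          closed_Collect_conj closed_Collect_le continuous_intros)
      ultimately have "emeasure lborel {x\<in>?D. t * egauge x \<le> 1} \<le> emeasure lborel ?B"
        by (intro emeasure_mono) auto
      also have "\<dots> = ennreal (\<Prod>i=1..CARD('n). ?m i - - ?m i)"
        using m by (intro emeasure_orthonormal_box[OF orthonormal]) (metis neg_le_0_iff_le order_trans)
      also have "(\<Prod>i=1..CARD('n). ?m i - - ?m i) = 2 ^ CARD('n) * (\<Prod>i=1..CARD('n). ?m i)"
        by (simp add: prod.distrib flip: mult_2)
      finally have "ennreal (?w t) * emeasure lborel {x\<in>?D. t * egauge x \<le> 1}
          \<le> ennreal (?w t) * ennreal (2 ^ CARD('n) * (\<Prod>i=1..CARD('n). ?m i))"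
        by (rule mult_left_mono) simp
      also have "\<dots> = ennreal (q * 2 ^ CARD('n) * box_profile CARD('n) q b t)"
        using assms prod_nonneg[of "{1..CARD('n)}" ?m] m
        by (subst ennreal_mult[symmetric]) (auto simp: box_profile_def mult_ac)
      finally show ?thesis .
    qed
    moreover have "ennreal (q * 2 ^ CARD('n) * box_profile CARD('n) q b t) = ennreal (q * 2 ^ CARD('n)) * ennreal (box_profile CARD('n) q b t)"
      using assms by (intro ennreal_mult') auto
    ultimately show "ennreal (?w t) * emeasure lborel {x\<in>?D. t * egauge x \<le> 1} * indicator {0<..b CARD('n)} t
        \<le> ennreal (q * 2 ^ CARD('n)) * (ennreal (box_profile CARD('n) q b t) * indicator {0<..b CARD('n)} t)"
      by (auto simp: indicator_def)
  qed
  also have "\<dots> = ennreal (q * 2 ^ CARD('n)) * box_profile_integral CARD('n) q b"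
    unfolding box_profile_integral_def by (rule nn_integral_cmult) measurable
  finally show ?thesis .
qed

text \<open>Since \<open>n\<close> times the square of \<open>d\<close> is 1, the box with
  half-widths \<open>d * min 1 (b i / t)\<close> lies both in the unit ball and in the sublevel set.
  Keeping the last coordinate above \<open>d / 2\<close> bounds the norm from below, so
  \<open>1 / egauge x\<close> can replace \<open>norm x / egauge x\<close> at the cost of
  \<open>(d / 2) powr q\<close>.\<close>

lemma sphere_ellipsoid_integral_ge:
  fixes q :: real
  defines "d \<equiv> 1 / sqrt (real CARD('n))"
  assumes "q > 0"
  shows "ennreal ((d / 2) powr q * (q * (d / 2) ^ CARD('n))) * box_profile_integral CARD('n) q b
    \<le> (\<integral>\<^sup>+x\<in>cball 0 1 - {0}. ennreal ((norm x / egauge x) powr q) \<partial>lborel)"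
proof -
  let ?w = "\<lambda>t. q * t powr (q - 1)"
  let ?D = "{x :: real ^ 'n. norm x \<le> 1 \<and> d / 2 \<le> norm x}"
  have d: "0 < d" "d\<^sup>2 * real CARD('n) = 1" by (auto simp: d_def power_divide)
  have d1: "d / 2 > 0" using d by simp
  have [measurable]: "?D \<in> sets borel" by measurable
  have "ennreal (q * (d / 2) ^ CARD('n)) * box_profile_integral CARD('n) q b =
     (\<integral>\<^sup>+t. ennreal (q * (d / 2) ^ CARD('n)) * (ennreal (box_profile CARD('n) q b t) * indicator {0<..b CARD('n)} t) \<partial>lborel)"
    unfolding box_profile_integral_def by (rule nn_integral_cmult[symmetric]) measurable
  also have "\<dots> \<le> (\<integral>\<^sup>+t\<in>{0<..b CARD('n)}. ennreal (?w t) * emeasure lborel {x\<in>?D. t * egauge x \<le> 1} \<partial>lborel)"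
  proof (rule nn_integral_mono)
    fix t :: real
    have "ennreal (q * (d / 2) ^ CARD('n) * box_profile CARD('n) q b t)
      \<le> ennreal (?w t) * emeasure lborel {x\<in>?D. t * egauge x \<le> 1}" if t: "0 < t" "t \<le> b CARD('n)"
    proof -
      let ?m = "\<lambda>i. min 1 (b i / t)"
      \<comment> \<open>Only the last coordinate is kept away from 0. For \<open>t \<le> b n\<close>
        the last minimum is 1, so that coordinate ranges over \<open>{d / 2..d}\<close>, and every
        edge has length at least \<open>d / 2 * ?m i\<close>.\<close>
      define l where "l = (\<lambda>i. if i = CARD('n) then d / 2 else - (d * ?m i))"
      let ?B = "{x. \<forall>i\<in>{1..CARD('n)}. l i \<le> x \<bullet> v i \<and> x \<bullet> v i \<le> d * ?m i}"
      have m: "0 \<le> ?m i" if "i \<in> {1..CARD('n)}" for i using pos[OF that] t by simp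
      have mn: "?m CARD('n) = 1" using t by simp
      have l: "d / 2 * ?m i \<le> d * ?m i - l i" if "i \<in> {1..CARD('n)}" for i
      proof (cases "i = CARD('n)")
        case True then show ?thesis using mn by (simp add: l_def)
      next
        case False
        have "0 \<le> d * ?m i" using m[OF that] d by simp
        then show ?thesis using False by (simp add: l_def)
      qed
      have "x \<in> {x\<in>?D. t * egauge x \<le> 1}" if "x \<in> ?B" for x
      proof -
        have x: "\<bar>x \<bullet> v i\<bar> \<le> d * ?m i" if "i \<in> {1..CARD('n)}" for i
        proof -
          have "l i \<le> x \<bullet> v i" "x \<bullet> v i \<le> d * ?m i"
            using \<open>x \<in> ?B\<close> that by auto
          then show ?thesis using d by (cases "i = CARD('n)") (auto simp: l_def)
        qed
        have x1: "\<bar>x \<bullet> v i\<bar> \<le> d" if "i \<in> {1..CARD('n)}" for i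
          using x[OF that] mult_left_mono[of "?m i" 1 d] d by linarith
        have x2: "\<bar>x \<bullet> v i\<bar> / b i \<le> d / t" if "i \<in> {1..CARD('n)}" for i
        proof -
          have "\<bar>x \<bullet> v i\<bar> \<le> d * (b i / t)"
            using x[OF that] mult_left_mono[of "?m i" "b i / t" d] d by linarith
          then show ?thesis using pos[OF that] t by (simp add: field_simps)
        qed
        have "(norm x)\<^sup>2 \<le> (\<Sum>i=1..CARD('n). d\<^sup>2)"
          unfolding norm_square_orthonormal[OF orthonormal] using x1 d
          by (intro sum_mono) (simp add: abs_le_square_iff[symmetric])
        then have "(norm x)\<^sup>2 \<le> 1" using d by (simp add: mult.commute)
        then have n1: "norm x \<le> 1" by (simp add: power_le_one_iff abs_square_le_1)
        have "(\<Sum>i=1..CARD('n). (x \<bullet> v i)\<^sup>2 / (b i)\<^sup>2) \<le> (\<Sum>i=1..CARD('n). (d / t)\<^sup>2)"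
        proof (rule sum_mono)
          fix i assume i: "i \<in> {1..CARD('n)}"
          have "(\<bar>x \<bullet> v i\<bar> / b i)\<^sup>2 \<le> (d / t)\<^sup>2"
            using x2[OF i] pos[OF i] by (intro power_mono) auto
          then show "(x \<bullet> v i)\<^sup>2 / (b i)\<^sup>2 \<le> (d / t)\<^sup>2" by (simp add: power_divide)
        qed
        also have "\<dots> = (1 / t)\<^sup>2" using d by (simp add: power_divide mult.commute)
        finally have "egauge x \<le> 1 / t"
          unfolding ellipsoid_gauge_def using t by (intro real_le_lsqrt) auto
        then have g: "t * egauge x \<le> 1" using t by (simp add: field_simps)
        have nN: "CARD('n) \<in> {1..CARD('n)}" using dim_ge_1 by simp
        have "norm (v CARD('n)) = 1"
          using orthonormal nN by (auto simp: orthonormal_family_def norm_eq_1)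
        then have "x \<bullet> v CARD('n) \<le> norm x" using norm_cauchy_schwarz[of x "v CARD('n)"] by simp
        moreover have "d / 2 \<le> x \<bullet> v CARD('n)"
          using bspec[OF CollectD[OF \<open>x \<in> ?B\<close>] nN] by (simp add: l_def)
        ultimately show ?thesis using n1 g by simp
      qed
      then have sub: "?B \<subseteq> {x\<in>?D. t * egauge x \<le> 1}" by blast
      have "(d / 2) ^ CARD('n) * (\<Prod>i=1..CARD('n). ?m i) = (\<Prod>i=1..CARD('n). d / 2 * ?m i)"
        by (subst prod.distrib) simp
      also have "\<dots> \<le> (\<Prod>i=1..CARD('n). d * ?m i - l i)"
        using l m d by (intro prod_mono) auto
      finally have "ennreal ((d / 2) ^ CARD('n) * (\<Prod>i=1..CARD('n). ?m i)) \<le> ennreal (\<Prod>i=1..CARD('n). d * ?m i - l i)"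
        by (rule ennreal_leI)
      also have "\<dots> = emeasure lborel ?B"
      proof (rule emeasure_orthonormal_box[OF orthonormal, symmetric])
        fix i assume i: "i \<in> {1..CARD('n)}"
        have "0 \<le> d / 2 * ?m i" using m[OF i] d by simp
        then show "l i \<le> d * ?m i" using l[OF i] by linarith
      qed
      also have "\<dots> \<le> emeasure lborel {x\<in>?D. t * egauge x \<le> 1}"
        using sub by (rule emeasure_mono) measurable
      finally have "ennreal (?w t) * ennreal ((d / 2) ^ CARD('n) * (\<Prod>i=1..CARD('n). ?m i)) \<le>
          ennreal (?w t) * emeasure lborel {x\<in>?D. t * egauge x \<le> 1}"
        by (rule mult_left_mono) simp
      moreover have "ennreal (?w t) * ennreal ((d / 2) ^ CARD('n) * (\<Prod>i=1..CARD('n). ?m i)) =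
          ennreal (q * (d / 2) ^ CARD('n) * box_profile CARD('n) q b t)"
        using assms prod_nonneg[of "{1..CARD('n)}" ?m] m d
        by (subst ennreal_mult[symmetric]) (auto simp: box_profile_def mult_ac)
      ultimately show ?thesis by simp
    qed
    moreover have "ennreal (q * (d / 2) ^ CARD('n) * box_profile CARD('n) q b t) =
        ennreal (q * (d / 2) ^ CARD('n)) * ennreal (box_profile CARD('n) q b t)"
      using assms d by (intro ennreal_mult') auto
    ultimately show "ennreal (q * (d / 2) ^ CARD('n)) * (ennreal (box_profile CARD('n) q b t) * indicator {0<..b CARD('n)} t)
      \<le> ennreal (?w t) * emeasure lborel {x\<in>?D. t * egauge x \<le> 1} * indicator {0<..b CARD('n)} t"
      by (auto simp: indicator_def)
  qed
  also have "\<dots> = (\<integral>\<^sup>+x\<in>?D. (\<integral>\<^sup>+t\<in>{t\<in>{0<..b CARD('n)}. t * egauge x \<le> 1}. ennreal (?w t) \<partial>lborel) \<partial>lborel)"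
    by (rule nn_integral_sublevel_swap[symmetric]) auto
  also have "\<dots> \<le> (\<integral>\<^sup>+x. ennreal ((1 / egauge x) powr q) * indicator ?D x \<partial>lborel)"
  proof (rule nn_integral_mono)
    fix x :: "real ^ 'n"
    have "(\<integral>\<^sup>+t\<in>{t\<in>{0<..b CARD('n)}. t * egauge x \<le> 1}. ennreal (?w t) \<partial>lborel) \<le> ennreal ((1 / egauge x) powr q)"
      if "x \<in> ?D"
    proof -
      have g: "0 < egauge x" using that d1 by (intro gauge_pos) auto
      \<comment> \<open>Forgetting the restriction \<open>t \<le> b n\<close> only enlarges the
        domain.\<close>
      have "(\<integral>\<^sup>+t\<in>{t\<in>{0<..b CARD('n)}. t * egauge x \<le> 1}. ennreal (?w t) \<partial>lborel)
          \<le> (\<integral>\<^sup>+t\<in>{0<..1 / egauge x}. ennreal (?w t) \<partial>lborel)"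
        using g by (intro nn_integral_mono) (auto simp: indicator_def field_simps)
      also have "\<dots> = ennreal ((1 / egauge x) powr q)"
        using nn_integral_powr_from_0[of "q - 1" "1 / egauge x" q] assms g by simp
      finally show ?thesis .
    qed
    then show "(\<integral>\<^sup>+t\<in>{t\<in>{0<..b CARD('n)}. t * egauge x \<le> 1}. ennreal (?w t) \<partial>lborel) * indicator ?D x
       \<le> ennreal ((1 / egauge x) powr q) * indicator ?D x"
      by (auto simp: indicator_def)
  qed
  finally have "ennreal ((d / 2) powr q) * (ennreal (q * (d / 2) ^ CARD('n)) * box_profile_integral CARD('n) q b)
    \<le> ennreal ((d / 2) powr q) * (\<integral>\<^sup>+x. ennreal ((1 / egauge x) powr q) * indicator ?D x \<partial>lborel)"
    by (rule mult_left_mono) simp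
  also have "\<dots> = (\<integral>\<^sup>+x. ennreal ((d / 2) powr q) * (ennreal ((1 / egauge x) powr q) * indicator ?D x) \<partial>lborel)"
    by (rule nn_integral_cmult[symmetric]) measurable
  \<comment> \<open>On the shell \<open>d / 2 \<le> norm x\<close>, and the shell omits the origin,
    so it is contained in the punctured ball.\<close>
  also have "\<dots> \<le> (\<integral>\<^sup>+x\<in>cball 0 1 - {0}. ennreal ((norm x / egauge x) powr q) \<partial>lborel)"
  proof (rule nn_integral_mono)
    fix x :: "real ^ 'n"
    have "ennreal ((d / 2) powr q) * ennreal ((1 / egauge x) powr q) \<le> ennreal ((norm x / egauge x) powr q)"
      if "x \<in> ?D"
    proof -
      have "(d / 2) powr q * (1 / egauge x) powr q = (d / 2 * (1 / egauge x)) powr q"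
        by (rule powr_mult[symmetric])
      also have "\<dots> \<le> (norm x / egauge x) powr q"
        using that assms d1 divide_right_mono[of "d / 2" "norm x" "egauge x"] ellipsoid_gauge_nonneg[of b v x]
        by (intro powr_mono2) simp_all
      finally show ?thesis by (subst ennreal_mult[symmetric]) (auto intro: ennreal_leI)
    qed
    then show "ennreal ((d / 2) powr q) * (ennreal ((1 / egauge x) powr q) * indicator ?D x)
      \<le> ennreal ((norm x / egauge x) powr q) * indicator (cball 0 1 - {0}) x"
      using d1 by (auto simp: indicator_def)
  qed
  finally show ?thesis
    using assms d by (simp add: ennreal_mult mult.assoc)
qed

end

section \<open>Dual mixed volumes\<close>

text \<open>The sphere measure is a scaled push-forward from the ball, so \<open>f\<close> is
  integrated as a function constant on rays and no radial Jacobian appears.\<close>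

lemma nn_integral_sphere_measure:
  fixes f :: "'a::euclidean_space \<Rightarrow> ennreal"
  assumes [measurable]: "f \<in> borel_measurable (restrict_space borel (sphere 0 1))"
  shows "(\<integral>\<^sup>+u. f u \<partial>sphere_measure) =
    of_nat DIM('a) * (\<integral>\<^sup>+x\<in>cball 0 1 - {0}. f (x /\<^sub>R norm x) \<partial>lborel)"
proof -
  let ?D = "cball 0 1 - {0::'a}"
  have D: "?D \<in> sets lborel" by auto
  have "(\<lambda>x::'a. x /\<^sub>R norm x) \<in> borel_measurable (restrict_space lborel ?D)"
    by (rule measurable_restrict_space1) measurable
  then have m: "(\<lambda>x::'a. x /\<^sub>R norm x) \<in> measurable (restrict_space lborel ?D) (restrict_space borel (sphere 0 1))"
    by (intro measurable_restrict_space2) (auto simp: space_restrict_space)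
  show ?thesis
    unfolding sphere_measure_def
    using D m by (simp add: nn_integral_scale_measure nn_integral_distr nn_integral_restrict_space)
qed

text \<open>The radial function is continuous on a compact sphere, so its extrema are attained and
  \<open>LEAST\<close> and \<open>GREATEST\<close> denote a true minimum and maximum.\<close>

lemma star_body_radial_bounds:
  fixes Q :: "'a::euclidean_space set"
  assumes "star_body Q"
  shows "0 < min_radial Q" "0 < max_radial Q"
    and "u \<in> sphere 0 1 \<Longrightarrow> min_radial Q \<le> radial Q u"
    and "u \<in> sphere 0 1 \<Longrightarrow> radial Q u \<le> max_radial Q"
proof -
  have c: "continuous_on (sphere 0 1) (radial Q)" and p: "\<forall>u\<in>sphere 0 1. 0 < radial Q u"
    using assms by (auto simp: star_body_def)
  have ne: "sphere (0::'a) 1 \<noteq> {}" by simp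
  obtain u0 where u0: "u0 \<in> sphere 0 1" "\<forall>u\<in>sphere 0 1. radial Q u0 \<le> radial Q u"
    using continuous_attains_inf[OF compact_sphere ne c] by auto
  obtain u1 where u1: "u1 \<in> sphere 0 1" "\<forall>u\<in>sphere 0 1. radial Q u \<le> radial Q u1"
    using continuous_attains_sup[OF compact_sphere ne c] by auto
  have m: "min_radial Q = radial Q u0"
    unfolding min_radial_def using u0 by (intro Least_equality) auto
  have M: "max_radial Q = radial Q u1"
    unfolding max_radial_def using u1 by (intro Greatest_equality) auto
  show "0 < min_radial Q" "0 < max_radial Q"
    "u \<in> sphere 0 1 \<Longrightarrow> min_radial Q \<le> radial Q u"
    "u \<in> sphere 0 1 \<Longrightarrow> radial Q u \<le> max_radial Q"
    using m M u0 u1 p by auto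
qed

text \<open>The power is monotone in its base, increasing or decreasing with the sign of
  \<open>p\<close>. Both signs occur for the exponent \<open>n - q\<close>, hence the minimum and
  maximum over the two endpoints.\<close>

lemma powr_between:
  fixes m M r p :: real
  assumes "0 < m" "m \<le> r" "r \<le> M"
  shows "min (m powr p) (M powr p) \<le> r powr p" "r powr p \<le> max (m powr p) (M powr p)"
proof -
  have "m powr p \<le> r powr p \<and> r powr p \<le> M powr p \<or> M powr p \<le> r powr p \<and> r powr p \<le> m powr p"
    using assms powr_mono2[of p m r] powr_mono2[of p r M] powr_mono2'[of p m r] powr_mono2'[of p r M]
    by (cases "0 \<le> p") auto
  then show "min (m powr p) (M powr p) \<le> r powr p" "r powr p \<le> max (m powr p) (M powr p)"
    by auto
qed

text \<open>The factor \<open>n\<close> of the sphere measure cancels the \<open>1 / n\<close> of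
  the dual mixed volume. What remains is the ball integral weighted by the power of the radial
  function of \<open>Q\<close>, which lies between \<open>min m M\<close> and
  \<open>max m M\<close>.\<close>

lemma dual_mixed_volume_ellipsoid_bounds:
  fixes Q :: "(real ^ 'n) set" and q :: real
  assumes ax: "ellipsoid_axes b v" and Q: "star_body Q"
    and lower: "ennreal r \<le> (\<integral>\<^sup>+x\<in>cball 0 1 - {0}. ennreal ((norm x / ellipsoid_gauge b v x) powr q) \<partial>lborel)"
    and upper: "(\<integral>\<^sup>+x\<in>cball 0 1 - {0}. ennreal ((norm x / ellipsoid_gauge b v x) powr q) \<partial>lborel) \<le> ennreal R"
    and "0 \<le> r" "0 \<le> R"
  defines "m \<equiv> min_radial Q powr (real CARD('n) - q)" and "M \<equiv> max_radial Q powr (real CARD('n) - q)"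
    and "E \<equiv> {x. (\<Sum>i=1..CARD('n). (x \<bullet> v i)\<^sup>2 / (b i)\<^sup>2) \<le> 1}"
  shows "min m M * r \<le> dual_mixed_volume q E Q" "dual_mixed_volume q E Q \<le> max m M * R"
proof -
  interpret ellipsoid_axes b v by (rule ax)
  let ?D = "cball 0 1 - {0 :: real ^ 'n}"
  let ?J = "(\<integral>\<^sup>+x\<in>?D. ennreal ((norm x / egauge x) powr q) \<partial>lborel)"
  have [measurable]: "?D \<in> sets borel" by simp
  define F where "F = (\<lambda>u. radial E u powr q * radial Q u powr (real CARD('n) - q))"
  have E: "radial E u = 1 / egauge u" if "u \<noteq> 0" for u
    unfolding E_def using that by (rule radial_ellipsoid)
  have "continuous_on (sphere 0 1) (\<lambda>u. 1 / egauge u)"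
    using gauge_pos by (intro continuous_intros continuous_on_ellipsoid_gauge ballI)
      (metis dist_0_norm less_irrefl mem_sphere norm_zero zero_neq_one)
  then have cE: "continuous_on (sphere 0 1) (radial E)"
    by (rule continuous_on_eq) (subst E, auto)
  have pE: "radial E u \<noteq> 0" if "u \<in> sphere 0 1" for u
    using E[of u] gauge_pos[of u] that by (cases "u = 0") auto
  have cQ: "continuous_on (sphere 0 1) (radial Q)" and pQ: "radial Q u \<noteq> 0" if "u \<in> sphere 0 1" for u
    using Q that unfolding star_body_def by force+
  \<comment> \<open>The condition on \<open>u\<close> is attached to \<open>cQ\<close> as well as to
    \<open>pQ\<close>; any point of the sphere discharges it.\<close>
  have u: "axis undefined 1 \<in> sphere (0 :: real ^ 'n) 1" by simp
  have "continuous_on (sphere 0 1) F"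
    unfolding F_def using pE pQ by (intro continuous_intros cE cQ[OF u]) auto
  then have F [measurable]: "F \<in> borel_measurable (restrict_space borel (sphere 0 1))"
    by (rule borel_measurable_continuous_on_restrict)
  have sets: "sets (sphere_measure :: (real ^ 'n) measure) = sets (restrict_space borel (sphere 0 1))"
    by (simp add: sphere_measure_def)
  have "F \<in> borel_measurable sphere_measure"
    using F by (simp add: measurable_cong_sets[OF sets refl])
  then have "(LINT u|sphere_measure. F u) = enn2real (\<integral>\<^sup>+u. ennreal (F u) \<partial>sphere_measure)"
    by (rule integral_eq_nn_integral) (simp add: F_def)
  also have "(\<integral>\<^sup>+u. ennreal (F u) \<partial>sphere_measure) =
      of_nat CARD('n) * (\<integral>\<^sup>+x\<in>?D. ennreal (F (x /\<^sub>R norm x)) \<partial>lborel)"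
    by (subst nn_integral_sphere_measure) auto
  finally have dmv: "dual_mixed_volume q E Q = enn2real (\<integral>\<^sup>+x\<in>?D. ennreal (F (x /\<^sub>R norm x)) \<partial>lborel)"
    by (simp add: dual_mixed_volume_def F_def enn2real_mult)
  have FD: "F (x /\<^sub>R norm x) = (norm x / egauge x) powr q * radial Q (x /\<^sub>R norm x) powr (real CARD('n) - q)"
    "x /\<^sub>R norm x \<in> sphere 0 1" if "x \<in> ?D" for x
  proof -
    have x: "x /\<^sub>R norm x \<noteq> 0" using that by simp
    have "radial E (x /\<^sub>R norm x) = norm x / egauge x"
      unfolding E[OF x] ellipsoid_gauge_scaleR by (simp add: divide_inverse)
    then show "F (x /\<^sub>R norm x) = (norm x / egauge x) powr q * radial Q (x /\<^sub>R norm x) powr (real CARD('n) - q)"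
      by (simp add: F_def)
    show "x /\<^sub>R norm x \<in> sphere 0 1" using that by simp
  qed
  note bounds = powr_between[OF star_body_radial_bounds(1)[OF Q] star_body_radial_bounds(3)[OF Q]
      star_body_radial_bounds(4)[OF Q], of _ "real CARD('n) - q", folded m_def M_def]
  have mM: "0 \<le> min m M" "0 \<le> max m M" by (simp_all add: m_def M_def le_max_iff_disj)
  have "ennreal (min m M * r) \<le> ennreal (min m M) * ?J"
    using mult_left_mono[OF lower, of "ennreal (min m M)"] mM \<open>0 \<le> r\<close> by (simp add: ennreal_mult)
  also have "\<dots> = (\<integral>\<^sup>+x. ennreal (min m M) * (ennreal ((norm x / egauge x) powr q) * indicator ?D x) \<partial>lborel)"
    by (rule nn_integral_cmult[symmetric]) measurable
  also have "\<dots> \<le> (\<integral>\<^sup>+x\<in>?D. ennreal (F (x /\<^sub>R norm x)) \<partial>lborel)"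
  proof (rule nn_integral_mono)
    fix x :: "real ^ 'n"
    have "ennreal (min m M) * ennreal ((norm x / egauge x) powr q) \<le> ennreal (F (x /\<^sub>R norm x))" if "x \<in> ?D"
      unfolding FD(1)[OF that] mult.commute[of "ennreal (min m M)"]
      using mult_left_mono[OF bounds(1)[OF FD(2)[OF that] FD(2)[OF that]], of "(norm x / egauge x) powr q"] mM
      by (subst ennreal_mult[symmetric]) (simp_all add: ennreal_leI)
    then show "ennreal (min m M) * (ennreal ((norm x / egauge x) powr q) * indicator ?D x)
        \<le> ennreal (F (x /\<^sub>R norm x)) * indicator ?D x"
      by (auto simp: indicator_def)
  qed
  finally have 1: "ennreal (min m M * r) \<le> (\<integral>\<^sup>+x\<in>?D. ennreal (F (x /\<^sub>R norm x)) \<partial>lborel)" .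
  have "(\<integral>\<^sup>+x\<in>?D. ennreal (F (x /\<^sub>R norm x)) \<partial>lborel)
      \<le> (\<integral>\<^sup>+x. ennreal (max m M) * (ennreal ((norm x / egauge x) powr q) * indicator ?D x) \<partial>lborel)"
  proof (rule nn_integral_mono)
    fix x :: "real ^ 'n"
    have "ennreal (F (x /\<^sub>R norm x)) \<le> ennreal (max m M) * ennreal ((norm x / egauge x) powr q)" if "x \<in> ?D"
      unfolding FD(1)[OF that] mult.commute[of "ennreal (max m M)"]
      using mult_left_mono[OF bounds(2)[OF FD(2)[OF that] FD(2)[OF that]], of "(norm x / egauge x) powr q"] mM
      by (subst ennreal_mult[symmetric]) (simp_all add: ennreal_leI)
    then show "ennreal (F (x /\<^sub>R norm x)) * indicator ?D x
        \<le> ennreal (max m M) * (ennreal ((norm x / egauge x) powr q) * indicator ?D x)"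
      by (auto simp: indicator_def)
  qed
  also have "\<dots> = ennreal (max m M) * ?J"
    by (rule nn_integral_cmult) measurable
  also have "\<dots> \<le> ennreal (max m M * R)"
    using mult_left_mono[OF upper, of "ennreal (max m M)"] mM \<open>0 \<le> R\<close> by (simp add: ennreal_mult)
  finally have 2: "(\<integral>\<^sup>+x\<in>?D. ennreal (F (x /\<^sub>R norm x)) \<partial>lborel) \<le> ennreal (max m M * R)" .
  show "dual_mixed_volume q E Q \<le> max m M * R"
    unfolding dmv using 2 mM \<open>0 \<le> R\<close> by (intro enn2real_leI) auto
  \<comment> \<open>The upper estimate is needed here too: \<open>enn2real\<close> sends
    \<open>top\<close> to 0, so its monotonicity requires a finite integral.\<close>
  show "min m M * r \<le> dual_mixed_volume q E Q"
    unfolding dmv using enn2real_mono[OF 1] 2 mM \<open>0 \<le> r\<close> by (simp add: le_less_trans)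
qed

theorem lemma4p3:
  fixes q :: real
  assumes "q > 0"
  shows "\<exists>c C :: real \<Rightarrow> real \<Rightarrow> real.
    \<forall>(Q :: (real ^ 'n) set) (E :: (real ^ 'n) set) (b :: nat \<Rightarrow> real).
      star_body Q \<longrightarrow> ellipsoid_with_semiaxes E b \<longrightarrow>
        0 < c (min_radial Q) (max_radial Q) \<and>
        c (min_radial Q) (max_radial Q)
          \<le> dual_mixed_volume q E Q / semiaxes_expression CARD('n) q b \<and>
        dual_mixed_volume q E Q / semiaxes_expression CARD('n) q b
          \<le> C (min_radial Q) (max_radial Q)"
proof -
  let ?n = "CARD('n)"
  let ?W = "semiaxes_expression ?n q"
  define p where "p = real ?n - q"
  have "1 \<le> ?n" by (simp add: Suc_leI)
  then obtain a A where a: "0 < a" "0 < A"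
    and G: "\<And>b. semiaxes ?n b \<Longrightarrow> 0 < ?W b \<and>
      ennreal (a * ?W b) \<le> box_profile_integral ?n q b \<and> box_profile_integral ?n q b \<le> ennreal (A * ?W b)"
    by (rule box_profile_integral_approx[OF assms]) blast
  define d where "d = 1 / sqrt (real ?n)"
  define c0 where "c0 = (d / 2) powr q * (q * (d / 2) ^ ?n)"
  define C0 where "C0 = q * 2 ^ ?n"
  have pos: "0 < c0" "0 < C0" using assms by (auto simp: c0_def C0_def d_def)
  \<comment> \<open>Each constant multiplies three contributions: the star body, the comparison of
    the ball integral with the profile integral, and that of the profile integral with the
    expression in the semi-axes.\<close>
  define c where "c = (\<lambda>m M. min (m powr p) (M powr p) * (c0 * a))"
  define C where "C = (\<lambda>m M. max (m powr p) (M powr p) * (C0 * A))"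
  have "0 < c (min_radial Q) (max_radial Q) \<and>
      c (min_radial Q) (max_radial Q) \<le> dual_mixed_volume q E Q / ?W b \<and>
      dual_mixed_volume q E Q / ?W b \<le> C (min_radial Q) (max_radial Q)"
    if Q: "star_body Q" and E: "ellipsoid_with_semiaxes E b" for Q E :: "(real ^ 'n) set" and b
  proof -
    obtain v where v: "orthonormal_family v" "E = {x. (\<Sum>i=1..?n. (x \<bullet> v i)\<^sup>2 / (b i)\<^sup>2) \<le> 1}"
      and b: "semiaxes ?n b"
      using E by (auto simp: ellipsoid_with_semiaxes_def orthonormal_family_def semiaxes_def)
    have ax: "ellipsoid_axes b v"
      using v(1) b by (simp add: ellipsoid_axes_def ellipsoid_axes_axioms_def)
    have W: "0 < ?W b" "ennreal (a * ?W b) \<le> box_profile_integral ?n q b"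
      "box_profile_integral ?n q b \<le> ennreal (A * ?W b)"
      using G[OF b] by auto
    let ?J = "\<integral>\<^sup>+x\<in>cball 0 1 - {0}. ennreal ((norm x / ellipsoid_gauge b v x) powr q) \<partial>lborel"
    have "ennreal (c0 * a * ?W b) \<le> ennreal c0 * box_profile_integral ?n q b"
      using mult_left_mono[OF W(2), of "ennreal c0"] W(1) pos a
      by (simp add: ennreal_mult mult.assoc)
    also have "\<dots> \<le> ?J"
      using ellipsoid_axes.sphere_ellipsoid_integral_ge[OF ax assms] by (simp add: c0_def d_def)
    finally have lower: "ennreal (c0 * a * ?W b) \<le> ?J" .
    have "?J \<le> ennreal C0 * box_profile_integral ?n q b"
      using ellipsoid_axes.sphere_ellipsoid_integral_le[OF ax assms] by (simp add: C0_def)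
    also have "\<dots> \<le> ennreal (C0 * A * ?W b)"
      using mult_left_mono[OF W(3), of "ennreal C0"] W(1) pos a
      by (simp add: ennreal_mult mult.assoc)
    finally have upper: "?J \<le> ennreal (C0 * A * ?W b)" .
    have "0 \<le> c0 * a * ?W b" "0 \<le> C0 * A * ?W b" using W pos a by auto
    note V = dual_mixed_volume_ellipsoid_bounds[OF ax Q lower upper this, folded v(2) p_def]
    have "0 < c (min_radial Q) (max_radial Q)"
      using star_body_radial_bounds(1,2)[OF Q] pos a by (simp add: c_def)
    then show ?thesis
      using V W(1) by (simp add: c_def C_def pos_le_divide_eq pos_divide_le_eq mult.assoc)
  qed
  then show ?thesis by blast
qed

end
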